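(* Let $V, W\subset\mathbb{R}^2$ be two simply connected domains (taken closed and bounded, see context). Suppose $u,v$ are harmonic functions over $V$ and let $\mathbf{F}=(u,v): V\to W$. Suppose that (1) $\mathbf{F}|_{\partial V}$ is an orientation preserving homeomorphism from the boundary $\partial V$ of $V$ onto the boundary $\partial W$ of $W$; (2) $\mathbf{F}\in C^0(V)\cap C^1(\mathring{V})$, where $\mathring{V}$ is the interior of $V$. If $W$ is convex, then $\mathbf{F}$ is a bijection from $V$ to $W$.
   Context: Here the domains $V$ and $W$ include their boundaries: each is a compact subset of $\mathbb{R}^2$ which is the closure of its nonempty, connected, simply connected interior and whose boundary is a Jordan curve. "Harmonic over $V$" means $\Delta u=u_{xx}+u_{yy}=0$ in the interior $\mathring{V}$. Orientation preserving means that $\mathbf{F}|_{\partial V}$ carries the counter-clockwise orientation of $\partial V$ to the counter-clockwise orientation of $\partial W$. *)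

theory Defs
  imports "HOL-Complex_Analysis.Complex_Analysis"
begin

text \<open>The Euclidean plane is the type \<^typ>\<open>complex\<close>, the point (x, y) being
  \<^term>\<open>Complex x y\<close>, so that the library's winding numbers apply.\<close>

definition jordan_curve :: "complex set \<Rightarrow> bool" where
  "jordan_curve C \<longleftrightarrow> (\<exists>g. simple_path g \<and> pathfinish g = pathstart g \<and> path_image g = C)"

definition closed_jordan_domain :: "complex set \<Rightarrow> bool" where
  "closed_jordan_domain V \<longleftrightarrow>
     compact V \<and> V = closure (interior V) \<and>
     interior V \<noteq> {} \<and> connected (interior V) \<and> simply_connected (interior V) \<and>
     jordan_curve (frontier V)"

text \<open>Meant for open sets only: the derivatives are full, not relative to the set.\<close>

definition C1_on :: "('a::real_normed_vector \<Rightarrow> 'b::real_normed_vector) \<Rightarrow> 'a set \<Rightarrow> bool" where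
  "C1_on f S \<longleftrightarrow>
     (\<exists>D :: 'a \<Rightarrow> 'a \<Rightarrow>\<^sub>L 'b.
        (\<forall>z\<in>S. (f has_derivative blinfun_apply (D z)) (at z)) \<and> continuous_on S D)"

definition partial_x :: "(complex \<Rightarrow> real) \<Rightarrow> complex \<Rightarrow> real" where
  "partial_x u z = deriv (\<lambda>x. u (Complex x (Im z))) (Re z)"

definition partial_y :: "(complex \<Rightarrow> real) \<Rightarrow> complex \<Rightarrow> real" where
  "partial_y u z = deriv (\<lambda>y. u (Complex (Re z) y)) (Im z)"

definition laplacian :: "(complex \<Rightarrow> real) \<Rightarrow> complex \<Rightarrow> real" where
  "laplacian u z = partial_x (partial_x u) z + partial_y (partial_y u) z"

definition C2_on :: "(complex \<Rightarrow> real) \<Rightarrow> complex set \<Rightarrow> bool" where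
  "C2_on u S \<longleftrightarrow> C1_on u S \<and> C1_on (partial_x u) S \<and> C1_on (partial_y u) S"

text \<open>Harmonicity over a set with boundary constrains the function only in the interior. The
  usual requirement of being twice continuously differentiable there ensures that the derivatives
  in the Laplacian exist (\<^const>\<open>deriv\<close> is total and unspecified at points of
  non-differentiability).\<close>

definition harmonic_over :: "(complex \<Rightarrow> real) \<Rightarrow> complex set \<Rightarrow> bool" where
  "harmonic_over u V \<longleftrightarrow>
     C2_on u (interior V) \<and> (\<forall>z\<in>interior V. laplacian u z = 0)"

definition ccw_boundary_loop :: "(real \<Rightarrow> complex) \<Rightarrow> complex set \<Rightarrow> bool" where
  "ccw_boundary_loop g V \<longleftrightarrow>
     simple_path g \<and> pathfinish g = pathstart g \<and> path_image g = frontier V \<and>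
     (\<forall>z\<in>interior V. winding_number g z = 1)"

text \<open>For a closed Jordan domain, any simple parametrisation of the boundary or its reversal is a
  counter-clockwise loop, so the quantifier over loops below is not vacuous.\<close>

definition orientation_preserving_boundary ::
    "(complex \<Rightarrow> complex) \<Rightarrow> complex set \<Rightarrow> complex set \<Rightarrow> bool" where
  "orientation_preserving_boundary F V W \<longleftrightarrow>
     (\<forall>g. ccw_boundary_loop g V \<longrightarrow> ccw_boundary_loop (F \<circ> g) W)"

end

theory Submission
  imports Defs
begin

text \<open>
  The argument is topological, by nodal lines, and uses no boundary regularity beyond continuity.

  For a nonzero vector \<open>c\<close> and a point \<open>z0\<close> of the interior of \<open>V\<close>, consider the harmonic
  function \<open>h z = c \<bullet> (F z - F z0)\<close>. By the maximum principle \<open>F z0\<close> is interior to \<open>W\<close>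
  (otherwise a supporting line of \<open>W\<close> at \<open>F z0\<close> would make a component of \<open>F\<close> constant), so the line
  through \<open>F z0\<close> orthogonal to \<open>c\<close> meets the convex curve \<open>frontier W\<close> in exactly two points. Since
  \<open>F\<close> is a homeomorphism of the boundaries, \<open>h\<close> is positive on one open arc of \<open>frontier V\<close>,
  negative on the complementary open arc, and zero at the two common end points.

  Each component of \<open>{h > 0}\<close> in the interior of \<open>V\<close> reaches the positive boundary arc by the maximum
  principle, and a Jordan domain is locally connected at its boundary (by Janiszewski's theorem);
  hence \<open>{h > 0}\<close> is connected, and so is \<open>{h < 0}\<close>: lemma \<open>positive_set_connected\<close>. If \<open>z0\<close> were a
  critical point of \<open>h\<close>, then \<open>h\<close> would have alternating signs on four successive rays from \<open>z0\<close>.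
  Joining the two positive rays inside \<open>{h > 0}\<close> and the two negative ones inside \<open>{h < 0}\<close>
  contradicts the Fashoda theorem: lemmas \<open>no_alternating_rays\<close> and \<open>Re_no_critical_zero\<close>. So no
  nontrivial linear combination of the components of \<open>F\<close> has a critical point, which means that the
  derivative of \<open>F\<close> is injective throughout the interior.

  Thus \<open>F\<close> is locally injective in the interior. As the boundary goes to the boundary, \<open>F\<close> restricts
  to a proper local homeomorphism from the interior of \<open>V\<close> to that of \<open>W\<close>, hence to a covering map.
  The target is simply connected, so the covering has a section, which must be onto:
  lemma \<open>proper_locally_injective_imp_bij_betw\<close>. Together with the given bijection of the boundaries
  this proves the theorem.
\<close>

section \<open>Harmonic functions as real parts of holomorphic functions\<close>

text \<open>The second difference over a square is expressed by the mixed derivative taken first in the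
  first variable; exchanging the roles of the variables gives the other order, whence the symmetry
  of mixed partial derivatives.\<close>

lemma second_difference_mvt:
  fixes u ux uxy :: "real \<Rightarrow> real \<Rightarrow> real"
  assumes "0 < s"
    and ux: "\<And>x y. x \<in> {a..a+s} \<Longrightarrow> y \<in> {b..b+s} \<Longrightarrow> ((\<lambda>t. u t y) has_real_derivative ux x y) (at x)"
    and uxy: "\<And>x y. x \<in> {a..a+s} \<Longrightarrow> y \<in> {b..b+s} \<Longrightarrow> (ux x has_real_derivative uxy x y) (at y)"
  shows "\<exists>x\<in>{a..a+s}. \<exists>y\<in>{b..b+s}.
           u (a+s) (b+s) - u a (b+s) - u (a+s) b + u a b = s * s * uxy x y"
proof -
  define \<phi> where "\<phi> = (\<lambda>x. u x (b+s) - u x b)"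
  have "\<exists>x. a < x \<and> x < a+s \<and> \<phi> (a+s) - \<phi> a = (a+s-a) * (ux x (b+s) - ux x b)"
    unfolding \<phi>_def using \<open>0 < s\<close> by (intro MVT2) (auto intro!: DERIV_diff ux)
  then obtain x where x: "a < x" "x < a+s" "\<phi> (a+s) - \<phi> a = s * (ux x (b+s) - ux x b)"
    by auto
  have "\<exists>y. b < y \<and> y < b+s \<and> ux x (b+s) - ux x b = (b+s-b) * uxy x y"
    using \<open>0 < s\<close> x by (intro MVT2) (auto intro!: uxy)
  then obtain y where "b < y" "y < b+s" "ux x (b+s) - ux x b = s * uxy x y"
    by auto
  with x show ?thesis
    by (intro bexI[of _ x] bexI[of _ y]) (auto simp: \<phi>_def algebra_simps)
qed

lemma mixed_partials_eq:
  fixes u ux uy :: "real \<Rightarrow> real \<Rightarrow> real" and uxy uyx :: "complex \<Rightarrow> real"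
  assumes S: "open S" "z \<in> S"
    and ux: "\<And>x y. Complex x y \<in> S \<Longrightarrow> ((\<lambda>t. u t y) has_real_derivative ux x y) (at x)"
    and uy: "\<And>x y. Complex x y \<in> S \<Longrightarrow> (u x has_real_derivative uy x y) (at y)"
    and uxy: "\<And>x y. Complex x y \<in> S \<Longrightarrow> (ux x has_real_derivative uxy (Complex x y)) (at y)"
    and uyx: "\<And>x y. Complex x y \<in> S \<Longrightarrow> ((\<lambda>t. uy t y) has_real_derivative uyx (Complex x y)) (at x)"
    and cont: "continuous_on S uxy" "continuous_on S uyx"
  shows "uxy z = uyx z"
proof (rule ccontr)
  assume ne: "uxy z \<noteq> uyx z"
  define e where "e = \<bar>uxy z - uyx z\<bar> / 2"
  have "e > 0" using ne by (simp add: e_def)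
  have "isCont uxy z" "isCont uyx z"
    using S cont continuous_on_eq_continuous_at by blast+
  then have "\<exists>d>0. \<forall>w. dist w z < d \<longrightarrow> dist (uxy w) (uxy z) < e"
    "\<exists>d>0. \<forall>w. dist w z < d \<longrightarrow> dist (uyx w) (uyx z) < e"
    unfolding continuous_at_eps_delta using \<open>e > 0\<close> by simp_all
  then obtain d1 d2 where d: "d1 > 0" "\<And>w. dist w z < d1 \<Longrightarrow> \<bar>uxy w - uxy z\<bar> < e"
    "d2 > 0" "\<And>w. dist w z < d2 \<Longrightarrow> \<bar>uyx w - uyx z\<bar> < e"
    unfolding dist_real_def by blast
  obtain d3 where d3: "d3 > 0" "ball z d3 \<subseteq> S"
    using S open_contains_ball by blast
  define r where "r = min d1 (min d2 d3)"
  define s where "s = r / 3"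
  have "r > 0" "s > 0" using d d3 by (auto simp: r_def s_def)
  have box: "dist (Complex x y) z < r" if "x \<in> {Re z..Re z + s}" "y \<in> {Im z..Im z + s}" for x y
  proof -
    have "dist (Complex x y) z \<le> \<bar>x - Re z\<bar> + \<bar>y - Im z\<bar>"
      using cmod_le[of "Complex x y - z"] by (simp add: dist_norm)
    also have "\<dots> < r" using that \<open>r > 0\<close> by (auto simp: s_def)
    finally show ?thesis .
  qed
  have inS: "Complex x y \<in> S" if "x \<in> {Re z..Re z + s}" "y \<in> {Im z..Im z + s}" for x y
    using box[OF that] d3 by (auto simp: r_def dist_commute subset_iff)
  obtain x y where 1: "x \<in> {Re z..Re z + s}" "y \<in> {Im z..Im z + s}"
     "u (Re z+s) (Im z+s) - u (Re z) (Im z+s) - u (Re z+s) (Im z) + u (Re z) (Im z)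
        = s * s * uxy (Complex x y)"
    using second_difference_mvt[OF \<open>s > 0\<close>, of "Re z" "Im z" u ux "\<lambda>x y. uxy (Complex x y)"]
      ux uxy inS by blast
  obtain y' x' where 2: "x' \<in> {Re z..Re z + s}" "y' \<in> {Im z..Im z + s}"
     "u (Re z+s) (Im z+s) - u (Re z+s) (Im z) - u (Re z) (Im z+s) + u (Re z) (Im z)
        = s * s * uyx (Complex x' y')"
    using second_difference_mvt[OF \<open>s > 0\<close>, of "Im z" "Re z" "\<lambda>y x. u x y" "\<lambda>y x. uy x y"
        "\<lambda>y x. uyx (Complex x y)"]
      uy uyx inS by blast
  have "s * s * uxy (Complex x y) = s * s * uyx (Complex x' y')"
    using 1 2 by linarith
  then have "uxy (Complex x y) = uyx (Complex x' y')"
    using \<open>s > 0\<close> by simp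
  moreover have "\<bar>uxy (Complex x y) - uxy z\<bar> < e" "\<bar>uyx (Complex x' y') - uyx z\<bar> < e"
    using box 1 2 d by (auto simp: r_def)
  ultimately show False by (auto simp: e_def abs_if split: if_splits)
qed

lemma has_derivative_imp_partial_x:
  assumes "(u has_derivative D) (at z)"
  shows "((\<lambda>x. u (Complex x (Im z))) has_real_derivative D 1) (at (Re z))"
proof -
  have "((\<lambda>x. Complex x (Im z)) has_derivative complex_of_real) (at (Re z))"
    by (auto intro!: derivative_eq_intros simp: Complex_eq)
  moreover have "(u has_derivative D) (at (Complex (Re z) (Im z)))"
    using assms by simp
  ultimately have "((\<lambda>x. u (Complex x (Im z))) has_derivative (\<lambda>t. D (of_real t))) (at (Re z))"
    by (rule has_derivative_compose)
  moreover have "D (of_real t) = D 1 * t" for t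
    using linear_scale[OF has_derivative_linear[OF assms], of t 1]
    by (simp add: scaleR_conv_of_real)
  ultimately show ?thesis by (simp add: has_field_derivative_def)
qed

lemma has_derivative_imp_partial_y:
  assumes "(u has_derivative D) (at z)"
  shows "((\<lambda>y. u (Complex (Re z) y)) has_real_derivative D \<i>) (at (Im z))"
proof -
  have "((\<lambda>y. Complex (Re z) y) has_derivative (\<lambda>t. \<i> * of_real t)) (at (Im z))"
    by (auto intro!: derivative_eq_intros simp: Complex_eq)
  moreover have "(u has_derivative D) (at (Complex (Re z) (Im z)))"
    using assms by simp
  ultimately have "((\<lambda>y. u (Complex (Re z) y)) has_derivative (\<lambda>t. D (\<i> * of_real t))) (at (Im z))"
    by (rule has_derivative_compose)
  moreover have "D (\<i> * of_real t) = D \<i> * t" for t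
    using linear_scale[OF has_derivative_linear[OF assms], of t \<i>]
    by (simp add: scaleR_conv_of_real mult.commute)
  ultimately show ?thesis by (simp add: has_field_derivative_def)
qed

lemma C1_on_partials:
  assumes "C1_on u S"
  shows "z \<in> S \<Longrightarrow> (u has_derivative (\<lambda>w. Re w * partial_x u z + Im w * partial_y u z)) (at z)"
    and "continuous_on S (partial_x u)" and "continuous_on S (partial_y u)"
proof -
  obtain D :: "complex \<Rightarrow> complex \<Rightarrow>\<^sub>L real"
    where D: "\<And>z. z \<in> S \<Longrightarrow> (u has_derivative blinfun_apply (D z)) (at z)"
      and cont: "continuous_on S D"
    using assms by (auto simp: C1_on_def)
  have px: "partial_x u z = D z 1" and py: "partial_y u z = D z \<i>" if "z \<in> S" for z
    unfolding partial_x_def partial_y_def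
    using DERIV_imp_deriv[OF has_derivative_imp_partial_x[OF D[OF that]]]
      DERIV_imp_deriv[OF has_derivative_imp_partial_y[OF D[OF that]]] by auto
  show "(u has_derivative (\<lambda>w. Re w * partial_x u z + Im w * partial_y u z)) (at z)" if "z \<in> S"
  proof -
    have *: "D z w = Re w * D z 1 + Im w * D z \<i>" for w
    proof -
      have "w = Re w *\<^sub>R 1 + Im w *\<^sub>R \<i>"
        by (simp add: complex_eq_iff)
      then have "D z w = D z (Re w *\<^sub>R 1 + Im w *\<^sub>R \<i>)" by simp
      then show ?thesis by (simp only: blinfun.add_right blinfun.scaleR_right) simp
    qed
    have "blinfun_apply (D z) = (\<lambda>w. Re w * partial_x u z + Im w * partial_y u z)"
      unfolding px[OF that] py[OF that] by (rule ext) (rule *)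
    then show ?thesis using D[OF that] by simp
  qed
  have "continuous_on S (\<lambda>z. D z 1)" "continuous_on S (\<lambda>z. D z \<i>)"
    using cont by (auto intro!: blinfun.continuous_on)
  then show "continuous_on S (partial_x u)" "continuous_on S (partial_y u)"
    by (simp_all add: px py cong: continuous_on_cong)
qed

text \<open>On a simply connected open set, \<open>u\<^sub>x - \<i> u\<^sub>y\<close> satisfies the Cauchy-Riemann equations and
  its primitive has real part \<open>u\<close> up to an additive constant.\<close>

lemma harmonic_imp_Re_holomorphic:
  assumes u: "harmonic_over u V" and sc: "simply_connected (interior V)"
  obtains f where "f holomorphic_on interior V" "\<And>z. z \<in> interior V \<Longrightarrow> Re (f z) = u z"
proof (cases "interior V = {}")
  case True
  then show ?thesis using that[of "\<lambda>_. 0"] by simp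
next
  case False
  define S where "S = interior V"
  have S: "open S" by (simp add: S_def)
  define ux uy where "ux = partial_x u" and "uy = partial_y u"
  have C1: "C1_on u S" "C1_on ux S" "C1_on uy S"
    using u by (auto simp: harmonic_over_def C2_on_def S_def ux_def uy_def)
  note du = C1_on_partials(1)[OF C1(1), folded ux_def uy_def]
  note dux = C1_on_partials(1)[OF C1(2)] and duy = C1_on_partials(1)[OF C1(3)]
  have lap: "partial_y uy z = - partial_x ux z" if "z \<in> S" for z
    using u that by (auto simp: harmonic_over_def laplacian_def S_def ux_def uy_def eq_neg_iff_add_eq_0 add.commute)
  have mixed: "partial_y ux z = partial_x uy z" if "z \<in> S" for z
  proof (rule mixed_partials_eq[OF S that, where u = "\<lambda>x y. u (Complex x y)"
        and ux = "\<lambda>x y. ux (Complex x y)" and uy = "\<lambda>x y. uy (Complex x y)"])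
    fix x y assume xy: "Complex x y \<in> S"
    show "((\<lambda>t. u (Complex t y)) has_real_derivative ux (Complex x y)) (at x)"
      using has_derivative_imp_partial_x[OF du[OF xy]] by simp
    show "((\<lambda>y. u (Complex x y)) has_real_derivative uy (Complex x y)) (at y)"
      using has_derivative_imp_partial_y[OF du[OF xy]] by simp
    show "((\<lambda>y. ux (Complex x y)) has_real_derivative partial_y ux (Complex x y)) (at y)"
      using has_derivative_imp_partial_y[OF dux[OF xy]] by simp
    show "((\<lambda>t. uy (Complex t y)) has_real_derivative partial_x uy (Complex x y)) (at x)"
      using has_derivative_imp_partial_x[OF duy[OF xy]] by simp
  qed (use C1_on_partials C1 in auto)
  define g where "g = (\<lambda>z. Complex (ux z) (- uy z))"
  have "(g has_field_derivative Complex (partial_x ux z) (- partial_x uy z)) (at z)" if "z \<in> S" for z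
  proof -
    have "(g has_derivative (\<lambda>w. Complex (Re w * partial_x ux z + Im w * partial_y ux z)
            (- (Re w * partial_x uy z + Im w * partial_y uy z)))) (at z)"
      unfolding g_def Complex_eq
      by (intro derivative_intros dux duy that)
    then show ?thesis
      by (rule has_derivative_imp_has_field_derivative)
         (auto simp: complex_eq_iff mixed lap that algebra_simps)
  qed
  then have "g holomorphic_on S"
    by (metis S at_within_open holomorphic_onI field_differentiable_def)
  then obtain h where h: "\<And>z. z \<in> S \<Longrightarrow> (h has_field_derivative g z) (at z)"
    using sc simply_connected_eq_global_primitive[OF S] unfolding S_def by blast
  have zero: "((\<lambda>z. Re (h z) - u z) has_derivative (\<lambda>w. 0)) (at z within S)" if "z \<in> S" for z
  proof -
    have "((\<lambda>z. Re (h z) - u z) has_derivative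
             (\<lambda>w. Re (g z * w) - (Re w * ux z + Im w * uy z))) (at z)"
      using h[OF that] unfolding has_field_derivative_def
      by (intro derivative_intros du that)
    then show ?thesis by (simp add: g_def algebra_simps has_derivative_at_withinI)
  qed
  have "connected S"
    using sc by (simp add: S_def simply_connected_imp_connected)
  moreover have "continuous_on S (\<lambda>z. Re (h z) - u z)"
    using zero by (rule has_derivative_continuous_on)
  ultimately obtain c where c: "\<And>z. z \<in> S \<Longrightarrow> Re (h z) - u z = c"
    using has_derivative_zero_connected_constant_on[of S "{}" "\<lambda>z. Re (h z) - u z"] zero S
    unfolding constant_on_def by auto
  show ?thesis
  proof
    show "(\<lambda>z. h z - of_real c) holomorphic_on interior V"
      using h S by (intro holomorphic_intros) (auto simp: S_def holomorphic_on_open)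
    show "Re (h z - of_real c) = u z" if "z \<in> interior V" for z
      using c[of z] that by (simp add: S_def)
  qed
qed

section \<open>Jordan curves and local connectedness at the boundary of a Jordan domain\<close>

lemma arc_minus_endpoints_connected:
  assumes "arc u" "pathstart u = a" "pathfinish u = b"
  shows "connected (path_image u - {a, b})"
proof -
  have inj: "inj_on u {0..1}" and cont: "continuous_on {0..1} u"
    using assms by (auto simp: arc_def path_def)
  have "path_image u - {a, b} = u ` ({0..1} - {0, 1})"
    using assms inj_on_image_set_diff[OF inj, of "{0..1}" "{0, 1}"]
    by (simp add: path_image_def pathstart_def pathfinish_def)
  also have "{0..1} - {0, 1} = {0<..<1::real}" by auto
  finally have "path_image u - {a, b} = u ` {0<..<1}" .
  moreover have "connected (u ` {0<..<1})"
    by (rule connected_continuous_image[OF continuous_on_subset[OF cont]]) auto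
  ultimately show ?thesis by simp
qed

lemma connected_nonzero_same_sign:
  fixes h :: "'a::topological_space \<Rightarrow> real"
  assumes "connected S" "continuous_on S h" "\<And>x. x \<in> S \<Longrightarrow> h x \<noteq> 0"
  shows "(\<forall>x\<in>S. 0 < h x) \<or> (\<forall>x\<in>S. h x < 0)"
proof (rule ccontr)
  assume "\<not> ?thesis"
  then obtain x y where xy: "x \<in> S" "y \<in> S" "h x \<le> 0" "0 \<le> h y"
    by (meson not_less)
  have "connected (h ` S)"
    using assms connected_continuous_image by blast
  then have "0 \<in> h ` S"
    using xy unfolding connected_iff_interval by blast
  with assms(3) show False by force
qed

lemma jordan_curve_positive_part_connected:
  fixes h :: "complex \<Rightarrow> real"
  assumes C: "jordan_curve C" and ab: "a \<in> C" "b \<in> C" "a \<noteq> b"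
    and h: "continuous_on C h" and zero: "\<And>z. z \<in> C \<Longrightarrow> h z = 0 \<longleftrightarrow> z = a \<or> z = b"
    and pos: "p \<in> C" "0 < h p" and neg: "q \<in> C" "h q < 0"
  shows "connected {z\<in>C. 0 < h z}"
proof -
  obtain g where g: "simple_path g" "pathfinish g = pathstart g" "path_image g = C"
    using C by (auto simp: jordan_curve_def)
  obtain u d where ud: "arc u" "arc d" "pathstart u = a" "pathfinish u = b"
      "pathstart d = b" "pathfinish d = a" "path_image u \<union> path_image d = C"
    using exists_double_arc[OF g(1,2), of a b] ab g(3) by metis
  define U where "U = path_image u - {a, b}"
  define D where "D = path_image d - {a, b}"
  have conn: "connected U" "connected D"
    using arc_minus_endpoints_connected[OF ud(1,3,4)] arc_minus_endpoints_connected[OF ud(2,5,6)]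
    by (auto simp: U_def D_def insert_commute)
  have UD: "U \<union> D = C - {a, b}" using ud(7) by (auto simp: U_def D_def)
  have sgnU: "(\<forall>x\<in>U. 0 < h x) \<or> (\<forall>x\<in>U. h x < 0)"
    by (rule connected_nonzero_same_sign[OF conn(1)])
       (use UD zero continuous_on_subset[OF h] in auto)
  have sgnD: "(\<forall>x\<in>D. 0 < h x) \<or> (\<forall>x\<in>D. h x < 0)"
    by (rule connected_nonzero_same_sign[OF conn(2)])
       (use UD zero continuous_on_subset[OF h] in auto)
  have pq: "p \<in> U \<union> D" "q \<in> U \<union> D" using pos neg zero UD by force+
  have eq: "{z\<in>C. 0 < h z} = {z\<in>U \<union> D. 0 < h z}"
    using UD zero by fastforce
  have "{z\<in>C. 0 < h z} = U \<or> {z\<in>C. 0 < h z} = D"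
    unfolding eq using sgnU sgnD pq pos neg by fastforce
  then show ?thesis using conn by auto
qed

text \<open>Let \<open>\<beta>\<close> be a closed subarc of the boundary which avoids \<open>p\<close> and contains every boundary point
  at distance \<open>e\<close> from \<open>p\<close>. Two interior points near \<open>p\<close> are separated neither by the boundary nor by
  \<open>\<beta>\<close> together with the circle of radius \<open>e\<close> about \<open>p\<close>; these two sets meet in the connected set
  \<open>\<beta>\<close>, so by Janiszewski's theorem their union does not separate the points either.\<close>

lemma closed_jordan_domain_boundary_locally_connected:
  assumes V: "closed_jordan_domain V" and p: "p \<in> frontier V" and "0 < e"
  obtains d where "0 < d"
    "\<And>x y. \<lbrakk>x \<in> interior V; dist p x < d; y \<in> interior V; dist p y < d\<rbrakk>
        \<Longrightarrow> connected_component (interior V \<inter> ball p e) x y"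
proof -
  have comp: "compact V" and conV: "connected (interior V)" and jc: "jordan_curve (frontier V)"
    using V by (auto simp: closed_jordan_domain_def)
  obtain g0 where g0: "simple_path g0" "pathfinish g0 = pathstart g0" "path_image g0 = frontier V"
    using jc by (auto simp: jordan_curve_def)
  have "p \<in> g0 ` {0..1}" using p g0(3) by (simp add: path_image_def)
  then obtain t where t: "t \<in> {0..1}" "g0 t = p" by blast
  \<comment> \<open>The parametrization is rotated to start and end at \<open>p\<close>.\<close>
  define g where "g = shiftpath t g0"
  have g: "simple_path g" "path_image g = frontier V" "g 0 = p" "g 1 = p"
    using g0 t endpoints_shiftpath[OF g0(2), of t]
    by (auto simp: g_def simple_path_shiftpath path_image_shiftpath pathstart_def pathfinish_def)
  have cont: "continuous_on {0..1} g" and loop_free: "loop_free g"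
    using g(1) by (auto simp: simple_path_def path_def)
  have "uniformly_continuous_on {0..1} g"
    using compact_uniformly_continuous[OF cont] by simp
  then obtain \<eta>0 where \<eta>0: "\<eta>0 > 0" "\<And>s s'. \<lbrakk>s \<in> {0..1}; s' \<in> {0..1}; dist s' s < \<eta>0\<rbrakk> \<Longrightarrow> dist (g s') (g s) < e"
    unfolding uniformly_continuous_on_def using \<open>0 < e\<close> by metis
  define \<eta> where "\<eta> = min \<eta>0 (1/4)"
  have \<eta>: "0 < \<eta>" "\<eta> \<le> \<eta>0" "\<eta> \<le> 1/4" using \<eta>0(1) by (auto simp: \<eta>_def)
  define \<beta> where "\<beta> = g ` {\<eta>..1-\<eta>}"
  have sub: "{\<eta>..1-\<eta>} \<subseteq> {0..1}" using \<eta> by auto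
  have \<beta>: "compact \<beta>" "connected \<beta>" "\<beta> \<subseteq> frontier V"
    using continuous_on_subset[OF cont sub] g(2) sub
    by (auto simp: \<beta>_def path_image_def intro!: compact_continuous_image connected_continuous_image)
  have "p \<notin> \<beta>"
  proof
    assume "p \<in> \<beta>"
    then obtain s where s: "s \<in> {\<eta>..1-\<eta>}" "g s = g 0" using g(3) by (auto simp: \<beta>_def)
    then show False
      using loop_free[unfolded loop_free_def, rule_format, of s 0] sub \<eta> by auto
  qed
  then obtain d0 where d0: "d0 > 0" "\<And>x. x \<in> \<beta> \<Longrightarrow> d0 \<le> dist p x"
    using separate_point_closed[of \<beta> p] \<beta>(1) \<open>p \<notin> \<beta>\<close> compact_imp_closed by blast
  have sph: "frontier V \<inter> sphere p e \<subseteq> \<beta>"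
  proof
    fix z assume z: "z \<in> frontier V \<inter> sphere p e"
    then have "z \<in> g ` {0..1}" using g(2) by (simp add: path_image_def)
    then obtain s where s: "s \<in> {0..1}" "z = g s" by blast
    have "\<not> dist s 0 < \<eta>0" "\<not> dist s 1 < \<eta>0"
      using \<eta>0(2)[of 0 s] \<eta>0(2)[of 1 s] s z g by (auto simp: dist_commute)
    then have "s \<in> {\<eta>..1-\<eta>}" using s(1) \<eta> by (auto simp: dist_real_def)
    then show "z \<in> \<beta>" using s by (auto simp: \<beta>_def)
  qed
  show ?thesis
  proof
    show "0 < min d0 e" using d0 \<open>0 < e\<close> by simp
    fix x y assume x: "x \<in> interior V" "dist p x < min d0 e" and y: "y \<in> interior V" "dist p y < min d0 e"
    have "connected_component (- (frontier V \<union> (\<beta> \<union> sphere p e))) x y"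
    proof (rule Janiszewski)
      show "compact (frontier V)" using comp by (simp add: compact_frontier)
      show "closed (\<beta> \<union> sphere p e)" using \<beta>(1) by (simp add: closed_Un compact_imp_closed)
      have "frontier V \<inter> (\<beta> \<union> sphere p e) = \<beta>" using sph \<beta>(3) by auto
      then show "connected (frontier V \<inter> (\<beta> \<union> sphere p e))" using \<beta>(2) by simp
      show "connected_component (- frontier V) x y"
        unfolding connected_component_def using conV x y
        by (intro exI[of _ "interior V"]) (auto simp: frontier_def)
      have "ball p (min d0 e) \<subseteq> - (\<beta> \<union> sphere p e)"
        using d0 by force
      then show "connected_component (- (\<beta> \<union> sphere p e)) x y"
        unfolding connected_component_def using x y
        by (intro exI[of _ "ball p (min d0 e)"]) auto
    qed
    then obtain T where T: "connected T" "T \<inter> frontier V = {}" "T \<inter> sphere p e = {}" "x \<in> T" "y \<in> T"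
      unfolding connected_component_def by blast
    have "T \<subseteq> V"
      using connected_Int_frontier[OF T(1), of V] T(2,4) x interior_subset by fastforce
    then have "T \<subseteq> interior V"
      using T(2) by (auto simp: frontier_def closure_def)
    moreover have "T \<subseteq> ball p e"
      using connected_Int_frontier[OF T(1), of "ball p e"] T(3,4) x \<open>0 < e\<close> by fastforce
    ultimately show "connected_component (interior V \<inter> ball p e) x y"
      using T unfolding connected_component_def by (intro exI[of _ T]) auto
  qed
qed

section \<open>Connectedness of the positivity set of a harmonic function\<close>

lemma Re_holomorphic_max_imp_constant:
  assumes f: "f holomorphic_on S" and S: "open S" "connected S" and z: "z \<in> S"
    and max: "\<And>w. w \<in> S \<Longrightarrow> Re (f w) \<le> Re (f z)" and w: "w \<in> S"
  shows "Re (f w) = Re (f z)"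
proof -
  have "(\<lambda>w. exp (f w)) constant_on S"
    by (rule maximum_modulus_principle[OF _ S, of _ S z])
       (use assms in \<open>auto intro!: holomorphic_intros\<close>)
  then have "exp (f w) = exp (f z)"
    using z w by (auto simp: constant_on_def)
  then show ?thesis
    by (metis exp_inj_iff norm_exp_eq_Re)
qed

text \<open>The maximum of \<open>h\<close> over the closure of a component of \<open>{h > 0}\<close> is attained on the boundary of
  \<open>V\<close>, or else \<open>h\<close> is a positive constant on the component, whose boundary then also lies in the
  boundary of \<open>V\<close>.\<close>

lemma positive_component_reaches_boundary:
  assumes V: "compact V" and h: "continuous_on V h"
    and f: "f holomorphic_on interior V" "\<And>z. z \<in> interior V \<Longrightarrow> Re (f z) = h z"
    and x: "x \<in> interior V" "0 < h x"
  obtains p where "p \<in> frontier V" "0 < h p"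
    "p \<in> closure (connected_component_set {z\<in>interior V. 0 < h z} x)"
proof -
  define U where "U = {z\<in>interior V. 0 < h z}"
  define C where "C = connected_component_set U x"
  have "continuous_on (interior V) h" using h interior_subset continuous_on_subset by blast
  then have "open U"
    using continuous_open_preimage[of "interior V" h "{0<..}"]
    by (simp add: U_def Collect_conj_eq vimage_def)
  have C: "open C" "connected C" "C \<subseteq> U" "x \<in> C"
    using \<open>open U\<close> x by (auto simp: C_def U_def open_connected_component connected_component_subset
        connected_component_in)
  have "C \<subseteq> V" using C(3) interior_subset by (auto simp: U_def)
  then have subV: "closure C \<subseteq> V" using V by (simp add: closure_minimal compact_imp_closed)
  have "compact (closure C)"
    using V \<open>C \<subseteq> V\<close> by (metis bounded_subset compact_closure compact_imp_bounded)
  then obtain q where q: "q \<in> closure C" "\<And>w. w \<in> closure C \<Longrightarrow> h w \<le> h q"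
    using continuous_attains_sup[of "closure C" h] continuous_on_subset[OF h subV] C(4) closure_subset
    by (metis empty_iff subsetD)
  have hq: "0 < h q" using q(2)[of x] C(4) x closure_subset by force
  have CU: "U \<inter> closure C = C"
  proof -
    have "closedin (top_of_set U) C" by (simp add: C_def closedin_connected_component)
    then obtain T where T: "closed T" "C = U \<inter> T" by (auto simp: closedin_closed)
    then have "closure C \<subseteq> T" by (intro closure_minimal) auto
    then show ?thesis using T closure_subset by blast
  qed
  show ?thesis
  proof (cases "q \<in> interior V")
    case False
    then have "q \<in> frontier V" using q(1) subV by (auto simp: frontier_def closure_def)
    then show ?thesis using that q(1) hq by (simp add: C_def U_def)
  next
    case True
    then have "q \<in> C" using CU hq q(1) by (auto simp: U_def)
    have sub: "C \<subseteq> interior V" using C(3) by (auto simp: U_def)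
    have const: "h w = h q" if "w \<in> C" for w
    proof -
      have "f holomorphic_on C" using f(1) sub by (rule holomorphic_on_subset)
      moreover have "Re (f w) \<le> Re (f q)" if "w \<in> C" for w
      proof -
        have "w \<in> closure C" using that closure_subset by blast
        moreover have "Re (f w) = h w" "Re (f q) = h q" using f(2) sub that \<open>q \<in> C\<close> by auto
        ultimately show ?thesis using q(2) by simp
      qed
      ultimately have "Re (f w) = Re (f q)"
        using Re_holomorphic_max_imp_constant C \<open>q \<in> C\<close> that by blast
      then show ?thesis using f(2) sub that \<open>q \<in> C\<close> by (metis subsetD)
    qed
    have const': "h w = h q" if "w \<in> closure C" for w
      using continuous_constant_on_closure[OF continuous_on_subset[OF h subV] const that] .
    have "C \<noteq> closure C"
    proof
      assume "C = closure C"
      then have "closed C" by (metis closed_closure)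
      then have "C = UNIV" using C clopen by blast
      then show False
        using \<open>compact (closure C)\<close> by (metis closure_UNIV not_compact_UNIV)
    qed
    then obtain p where p: "p \<in> closure C" "p \<notin> C" using closure_subset by blast
    have "0 < h p" using const'[OF p(1)] hq by simp
    moreover have "p \<in> frontier V"
      using p CU \<open>0 < h p\<close> subV by (auto simp: U_def frontier_def closure_def)
    ultimately show ?thesis using that p(1) by (simp add: C_def U_def)
  qed
qed

text \<open>Near a boundary point with \<open>h > 0\<close> only one component of the positivity set is present, and
  this component is locally constant along the connected positive part of the boundary. Since every
  component reaches that part, there is just one.\<close>

lemma positive_set_connected:
  assumes V: "closed_jordan_domain V" and h: "continuous_on V h"
    and f: "f holomorphic_on interior V" "\<And>z. z \<in> interior V \<Longrightarrow> Re (f z) = h z"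
    and A: "connected {p\<in>frontier V. 0 < h p}"
  shows "connected {z\<in>interior V. 0 < h z}"
proof -
  define U where "U = {z\<in>interior V. 0 < h z}"
  define A where "A = {p\<in>frontier V. 0 < h p}"
  have comp: "compact V" and clos: "V = closure (interior V)"
    using V by (auto simp: closed_jordan_domain_def)
  \<comment> \<open>\<open>R p q\<close>: all interior points near \<open>p\<close> and near \<open>q\<close> lie in the same component.\<close>
  define R where "R = (\<lambda>p q. \<exists>d>0. \<forall>x\<in>interior V. \<forall>y\<in>interior V.
      dist p x < d \<longrightarrow> dist q y < d \<longrightarrow> connected_component U x y)"
  have near: "\<exists>x\<in>interior V. dist p x < d" if "p \<in> V" "d > 0" for p d
    using that clos by (metis closure_approachable dist_commute)
  have AV: "A \<subseteq> V" using comp by (auto simp: A_def frontier_def closure_closed compact_imp_closed)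
  have R_local: "\<exists>d>0. \<forall>q. dist p q < d \<longrightarrow> R p q" if p: "p \<in> A" for p
  proof -
    have "p \<in> V" "0 < h p" using p AV by (auto simp: A_def)
    then obtain e where e: "e > 0" "\<And>z. z \<in> V \<Longrightarrow> dist z p < e \<Longrightarrow> dist (h z) (h p) < h p"
      using h unfolding continuous_on_iff by metis
    have sub: "interior V \<inter> ball p e \<subseteq> U"
    proof
      fix z assume z: "z \<in> interior V \<inter> ball p e"
      then have "dist (h z) (h p) < h p"
        using e(2)[of z] interior_subset by (auto simp: dist_commute)
      then show "z \<in> U" using z by (auto simp: U_def dist_real_def)
    qed
    obtain d where d: "0 < d" "\<And>x y. \<lbrakk>x \<in> interior V; dist p x < d; y \<in> interior V; dist p y < d\<rbrakk>
        \<Longrightarrow> connected_component (interior V \<inter> ball p e) x y"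
      using closed_jordan_domain_boundary_locally_connected[OF V _ e(1), of p] p
      by (auto simp: A_def)
    have "R p q" if "dist p q < d/2" for q
    proof -
      have "connected_component U x y"
        if xy: "x \<in> interior V" "y \<in> interior V" "dist p x < d/2" "dist q y < d/2" for x y
      proof -
        have "dist p y < d" using xy \<open>dist p q < d/2\<close> dist_triangle[of p y q] by linarith
        then show ?thesis
          using connected_component_mono[OF sub] d(2)[of x y] xy \<open>0 < d\<close> by force
      qed
      then show ?thesis unfolding R_def using \<open>0 < d\<close> by (intro exI[of _ "d/2"]) auto
    qed
    then show ?thesis using \<open>0 < d\<close> by (intro exI[of _ "d/2"]) auto
  qed
  have R_all: "R p q" if "p \<in> A" "q \<in> A" for p q
  proof (rule connected_equivalence_relation[of A p q R])
    show "connected A" using A by (simp add: A_def)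
    show "R y x" if "R x y" for x y
      using that unfolding R_def by (meson connected_component_sym)
    show "R x z" if xy: "R x y" and yz: "R y z" and "y \<in> A" for x y z
    proof -
      obtain d1 where d1: "d1 > 0" "\<And>a b. \<lbrakk>a \<in> interior V; b \<in> interior V; dist x a < d1; dist y b < d1\<rbrakk>
        \<Longrightarrow> connected_component U a b" using xy unfolding R_def by blast
      obtain d2 where d2: "d2 > 0" "\<And>a b. \<lbrakk>a \<in> interior V; b \<in> interior V; dist y a < d2; dist z b < d2\<rbrakk>
        \<Longrightarrow> connected_component U a b" using yz unfolding R_def by blast
      obtain w where w: "w \<in> interior V" "dist y w < min d1 d2"
        using near[of y "min d1 d2"] \<open>y \<in> A\<close> AV d1(1) d2(1) by auto
      have "connected_component U a b"
        if "a \<in> interior V" "b \<in> interior V" "dist x a < min d1 d2" "dist z b < min d1 d2" for a b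
        using d1(2)[of a w] d2(2)[of w b] w that by (auto intro: connected_component_trans)
      then show ?thesis
        unfolding R_def using d1(1) d2(1) by (intro exI[of _ "min d1 d2"]) auto
    qed
    show "\<exists>T. openin (top_of_set A) T \<and> a \<in> T \<and> (\<forall>x\<in>T. R a x)" if a: "a \<in> A" for a
    proof -
      obtain d where "d > 0" "\<And>q. dist a q < d \<Longrightarrow> R a q" using R_local[OF a] by blast
      then show ?thesis
        using a by (intro exI[of _ "A \<inter> ball a d"]) (auto simp: openin_open)
    qed
  qed (use that in auto)
  have "connected_component U x y" if x: "x \<in> U" and y: "y \<in> U" for x y
  proof -
    obtain p where p: "p \<in> A" "p \<in> closure (connected_component_set U x)"
      using positive_component_reaches_boundary[OF comp h f] x
      unfolding U_def A_def by blast
    obtain q where q: "q \<in> A" "q \<in> closure (connected_component_set U y)"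
      using positive_component_reaches_boundary[OF comp h f] y
      unfolding U_def A_def by blast
    obtain d where d: "d > 0" "\<And>a b. \<lbrakk>a \<in> interior V; b \<in> interior V; dist p a < d; dist q b < d\<rbrakk>
        \<Longrightarrow> connected_component U a b" using R_all[OF p(1) q(1)] unfolding R_def by blast
    obtain a where a: "connected_component U x a" "dist p a < d"
      using p(2) d(1) by (metis closure_approachable dist_commute mem_Collect_eq)
    obtain b where b: "connected_component U y b" "dist q b < d"
      using q(2) d(1) by (metis closure_approachable dist_commute mem_Collect_eq)
    have "a \<in> U" "b \<in> U" using a b connected_component_in by fast+
    then have "connected_component U a b" using d a b by (auto simp: U_def)
    then show ?thesis using a b by (meson connected_component_sym connected_component_trans)
  qed
  then show ?thesis unfolding U_def[symmetric] connected_iff_connected_component by blast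
qed

section \<open>Alternating rays and the Fashoda theorem\<close>

text \<open>The path may be chosen outside the disc of radius \<open>s\<close> about \<open>z0\<close>, touching the circle only at
  its two end points.\<close>

lemma path_between_rays:
  assumes A: "open A" "connected A" "z0 \<notin> A" and "0 < r"
    and rays: "\<And>\<rho>. \<lbrakk>0 < \<rho>; \<rho> \<le> r\<rbrakk> \<Longrightarrow> z0 + rcis \<rho> \<alpha> \<in> A" "\<And>\<rho>. \<lbrakk>0 < \<rho>; \<rho> \<le> r\<rbrakk> \<Longrightarrow> z0 + rcis \<rho> \<beta> \<in> A"
  obtains d where "0 < d" and "\<And>s. \<lbrakk>0 < s; s < d\<rbrakk> \<Longrightarrow>
    \<exists>g. path g \<and> path_image g \<subseteq> A \<and> pathstart g = z0 + rcis s \<alpha> \<and> pathfinish g = z0 + rcis s \<beta> \<and>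
        (\<forall>z\<in>path_image g. s < dist z0 z \<or> z = z0 + rcis s \<alpha> \<or> z = z0 + rcis s \<beta>)"
proof -
  have "path_connected A" using A by (simp add: connected_open_path_connected)
  then obtain p where p: "path p" "path_image p \<subseteq> A" "pathstart p = z0 + rcis r \<alpha>" "pathfinish p = z0 + rcis r \<beta>"
    using rays \<open>0 < r\<close> unfolding path_connected_def by blast
  have "z0 \<notin> path_image p" using p A by auto
  then obtain d0 where d0: "d0 > 0" "\<And>z. z \<in> path_image p \<Longrightarrow> d0 \<le> dist z0 z"
    using separate_point_closed[OF closed_path_image[OF p(1)], of z0] by blast
  have seg: "z \<in> A \<and> (s < dist z0 z \<or> z = z0 + rcis s \<gamma>)"
    if "z \<in> closed_segment (z0 + rcis s \<gamma>) (z0 + rcis r \<gamma>)" "0 < s" "s < r"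
      "\<And>\<rho>. \<lbrakk>0 < \<rho>; \<rho> \<le> r\<rbrakk> \<Longrightarrow> z0 + rcis \<rho> \<gamma> \<in> A" for z s \<gamma>
  proof -
    obtain u where u: "0 \<le> u" "u \<le> 1" "z = (1 - u) *\<^sub>R (z0 + rcis s \<gamma>) + u *\<^sub>R (z0 + rcis r \<gamma>)"
      using \<open>z \<in> _\<close> by (auto simp: closed_segment_def)
    define \<rho> where "\<rho> = s + u * (r - s)"
    have z: "z = z0 + rcis \<rho> \<gamma>"
      unfolding u(3) \<rho>_def by (simp add: rcis_def scaleR_conv_of_real algebra_simps)
    have "0 \<le> u * (r - s)" "u * (r - s) \<le> r - s"
      using u(1,2) that(3) mult_right_mono[of u 1 "r - s"] by simp_all
    then have \<rho>: "s \<le> \<rho>" "\<rho> \<le> r" unfolding \<rho>_def by (linarith, linarith)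
    have "dist z0 z = \<rho>" using \<rho> that(2) by (simp add: z dist_norm)
    then show ?thesis using \<rho> that(2,4) z by (cases "s = \<rho>") auto
  qed
  show ?thesis
  proof (rule that)
    show "0 < min d0 r" using d0 \<open>0 < r\<close> by simp
    fix s assume s: "0 < s" "s < min d0 r"
    define g where "g = linepath (z0 + rcis s \<alpha>) (z0 + rcis r \<alpha>) +++ (p +++ linepath (z0 + rcis r \<beta>) (z0 + rcis s \<beta>))"
    have im: "path_image g = closed_segment (z0 + rcis s \<alpha>) (z0 + rcis r \<alpha>) \<union>
        (path_image p \<union> closed_segment (z0 + rcis s \<beta>) (z0 + rcis r \<beta>))"
      unfolding g_def using p by (simp add: path_image_join closed_segment_commute)
    have "path g" "pathstart g = z0 + rcis s \<alpha>" "pathfinish g = z0 + rcis s \<beta>"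
      unfolding g_def using p by auto
    moreover have "z \<in> A \<and> (s < dist z0 z \<or> z = z0 + rcis s \<alpha> \<or> z = z0 + rcis s \<beta>)" if "z \<in> path_image g" for z
      using that seg[of z s \<alpha>] seg[of z s \<beta>] d0(2)[of z] s p(2) rays unfolding im by auto
    ultimately show "\<exists>g. path g \<and> path_image g \<subseteq> A \<and> pathstart g = z0 + rcis s \<alpha> \<and> pathfinish g = z0 + rcis s \<beta> \<and>
        (\<forall>z\<in>path_image g. s < dist z0 z \<or> z = z0 + rcis s \<alpha> \<or> z = z0 + rcis s \<beta>)"
      by blast
  qed
qed

text \<open>The Moebius transformation \<open>\<i> (z + 1) / (z - 1)\<close>, with values in the type \<open>real^2\<close> for which
  the Fashoda theorem is stated. It maps the exterior of the unit disc to the upper half-plane and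
  the unit circle without 1 to the real axis. The pole 1 itself is avoided
  throughout.\<close>

definition exterior_to_halfplane :: "complex \<Rightarrow> real^2" where
  "exterior_to_halfplane z = 
    (\<chi> i. if i = 1 then 2 * Im z / (cmod (z - 1))\<^sup>2 else ((cmod z)\<^sup>2 - 1) / (cmod (z - 1))\<^sup>2)"

lemma exterior_to_halfplane_nth:
  "exterior_to_halfplane z $ 1 = 2 * Im z / (cmod (z - 1))\<^sup>2"
  "exterior_to_halfplane z $ 2 = ((cmod z)\<^sup>2 - 1) / (cmod (z - 1))\<^sup>2"
  by (simp_all add: exterior_to_halfplane_def)

lemma exterior_to_halfplane_moebius:
  assumes "z \<noteq> 1"
  shows "\<i> * (z + 1) / (z - 1) = Complex (exterior_to_halfplane z $ 1) (exterior_to_halfplane z $ 2)"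
proof -
  have "\<i> * (z + 1) / (z - 1) = \<i> * (z + 1) * cnj (z - 1) / of_real ((cmod (z - 1))\<^sup>2)"
  proof -
    have "complex_of_real ((cmod (z - 1))\<^sup>2) = (z - 1) * cnj (z - 1)"
      by (rule complex_norm_square)
    moreover have "cnj (z - 1) \<noteq> 0" using assms by simp
    ultimately show ?thesis by (simp del: complex_cnj_diff)
  qed
  also have "\<i> * (z + 1) * cnj (z - 1) = Complex (2 * Im z) ((cmod z)\<^sup>2 - 1)"
    by (simp add: complex_eq_iff cmod_power2) (simp add: algebra_simps power2_eq_square)
  finally show ?thesis
    unfolding exterior_to_halfplane_nth by (simp add: complex_eq_iff)
qed

lemma exterior_to_halfplane_inj:
  assumes "exterior_to_halfplane z = exterior_to_halfplane w" "z \<noteq> 1" "w \<noteq> 1"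
  shows "z = w"
proof -
  have "\<i> * (z + 1) / (z - 1) = \<i> * (w + 1) / (w - 1)"
    using exterior_to_halfplane_moebius assms by simp
  then have "(z + 1) * (w - 1) = (w + 1) * (z - 1)"
    using assms by (simp add: frac_eq_eq)
  then have "2 * (w - z) = 0" by (simp add: algebra_simps)
  then show ?thesis by simp
qed

lemma exterior_to_halfplane_cis:
  assumes "0 < t" "t < 2 * pi"
  shows "cis t \<noteq> 1" "exterior_to_halfplane (cis t) $ 1 = cos (t/2) / sin (t/2)"
    "exterior_to_halfplane (cis t) $ 2 = 0"
proof -
  have s: "sin (t/2) > 0" using assms by (intro sin_gt_zero) auto
  have sn: "sin t = 2 * sin (t/2) * cos (t/2)" using sin_double[of "t/2"] by simp
  have cs: "cos t = 1 - 2 * (sin (t/2))\<^sup>2" using cos_double_sin[of "t/2"] by simp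
  show "cis t \<noteq> 1" using s cs by (auto simp: complex_eq_iff)
  have "(cmod (cis t - 1))\<^sup>2 = 4 * (sin (t/2))\<^sup>2"
  proof -
    have "(cmod (cis t - 1))\<^sup>2 = (cos t - 1)\<^sup>2 + (sin t)\<^sup>2" by (simp add: cmod_power2)
    also have "\<dots> = 2 - 2 * cos t" using sin_cos_squared_add[of t] by (simp add: power2_diff)
    finally show ?thesis by (simp add: cs)
  qed
  then show "exterior_to_halfplane (cis t) $ 1 = cos (t/2) / sin (t/2)"
    unfolding exterior_to_halfplane_nth using s by (simp add: sn power2_eq_square field_simps)
  show "exterior_to_halfplane (cis t) $ 2 = 0"
    unfolding exterior_to_halfplane_nth by simp
qed

text \<open>On the unit circle the map is \<open>cot (t/2)\<close>, which reverses the order of the angles.\<close>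

lemma exterior_to_halfplane_cis_mono:
  assumes "0 < s" "s < t" "t < 2 * pi"
  shows "exterior_to_halfplane (cis t) $ 1 < exterior_to_halfplane (cis s) $ 1"
proof -
  have pos: "sin (s/2) > 0" "sin (t/2) > 0" "sin (t/2 - s/2) > 0"
    using assms by (auto intro!: sin_gt_zero)
  have "sin (s/2) * cos (t/2) < cos (s/2) * sin (t/2)"
    using pos(3) unfolding sin_diff by (simp add: mult.commute)
  then have "cos (t/2) / sin (t/2) < cos (s/2) / sin (s/2)"
    using pos(1,2) by (simp add: field_simps)
  then show ?thesis
    using assms exterior_to_halfplane_cis(2)[of s] exterior_to_halfplane_cis(2)[of t] by simp
qed

lemma continuous_on_exterior_to_halfplane:
  assumes "1 \<notin> S"
  shows "continuous_on S exterior_to_halfplane"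
  unfolding exterior_to_halfplane_def
proof (rule continuous_on_vec_lambda)
  fix i :: 2
  have "cmod (z - 1) \<noteq> 0" if "z \<in> S" for z using that assms by auto
  then show "continuous_on S (\<lambda>z. if i = 1 then 2 * Im z / (cmod (z - 1))\<^sup>2
      else ((cmod z)\<^sup>2 - 1) / (cmod (z - 1))\<^sup>2)"
    by (cases "i = 1") (auto intro!: continuous_intros)
qed

text \<open>Disjoint connected open sets cannot occupy four rays from a point alternately. Otherwise, paths
  joining opposite ends of the rays outside a small disc would be carried by the Moebius
  transformation above to paths in a half-plane whose end points interlace on its boundary, and
  these must cross.\<close>

lemma no_alternating_rays:
  assumes A: "open A" "connected A" "z0 \<notin> A" and B: "open B" "connected B" "z0 \<notin> B"
    and disj: "A \<inter> B = {}" and "0 < r"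
    and t: "0 < t1" "t1 < t2" "t2 < t3" "t3 < t4" "t4 < 2 * pi"
    and rays: "\<And>\<rho>. \<lbrakk>0 < \<rho>; \<rho> \<le> r\<rbrakk> \<Longrightarrow> z0 + rcis \<rho> (\<theta> + t1) \<in> A"
      "\<And>\<rho>. \<lbrakk>0 < \<rho>; \<rho> \<le> r\<rbrakk> \<Longrightarrow> z0 + rcis \<rho> (\<theta> + t2) \<in> B"
      "\<And>\<rho>. \<lbrakk>0 < \<rho>; \<rho> \<le> r\<rbrakk> \<Longrightarrow> z0 + rcis \<rho> (\<theta> + t3) \<in> A"
      "\<And>\<rho>. \<lbrakk>0 < \<rho>; \<rho> \<le> r\<rbrakk> \<Longrightarrow> z0 + rcis \<rho> (\<theta> + t4) \<in> B"
  shows False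
proof -
  obtain dA where dA: "0 < dA" "\<And>s. \<lbrakk>0 < s; s < dA\<rbrakk> \<Longrightarrow>
    \<exists>g. path g \<and> path_image g \<subseteq> A \<and> pathstart g = z0 + rcis s (\<theta> + t3) \<and> pathfinish g = z0 + rcis s (\<theta> + t1) \<and>
        (\<forall>z\<in>path_image g. s < dist z0 z \<or> z = z0 + rcis s (\<theta> + t3) \<or> z = z0 + rcis s (\<theta> + t1))"
    using path_between_rays[OF A \<open>0 < r\<close> rays(3) rays(1)] by blast
  obtain dB where dB: "0 < dB" "\<And>s. \<lbrakk>0 < s; s < dB\<rbrakk> \<Longrightarrow>
    \<exists>g. path g \<and> path_image g \<subseteq> B \<and> pathstart g = z0 + rcis s (\<theta> + t4) \<and> pathfinish g = z0 + rcis s (\<theta> + t2) \<and>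
        (\<forall>z\<in>path_image g. s < dist z0 z \<or> z = z0 + rcis s (\<theta> + t4) \<or> z = z0 + rcis s (\<theta> + t2))"
    using path_between_rays[OF B \<open>0 < r\<close> rays(4) rays(2)] by blast
  define s where "s = min dA dB / 2"
  have s: "0 < s" "s < dA" "s < dB" using dA(1) dB(1) by (auto simp: s_def)
  obtain gA where gA: "path gA" "path_image gA \<subseteq> A" "pathstart gA = z0 + rcis s (\<theta> + t3)"
    "pathfinish gA = z0 + rcis s (\<theta> + t1)"
    "\<And>z. z\<in>path_image gA \<Longrightarrow> s < dist z0 z \<or> z = z0 + rcis s (\<theta> + t3) \<or> z = z0 + rcis s (\<theta> + t1)"
    using dA(2)[OF s(1,2)] by blast
  obtain gB where gB: "path gB" "path_image gB \<subseteq> B" "pathstart gB = z0 + rcis s (\<theta> + t4)"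
    "pathfinish gB = z0 + rcis s (\<theta> + t2)"
    "\<And>z. z\<in>path_image gB \<Longrightarrow> s < dist z0 z \<or> z = z0 + rcis s (\<theta> + t4) \<or> z = z0 + rcis s (\<theta> + t2)"
    using dB(2)[OF s(1,3)] by blast
  \<comment> \<open>\<open>N\<close> maps the circle of radius \<open>s\<close> about \<open>z0\<close> to the unit circle and the direction \<open>\<theta>\<close> to 1.\<close>
  define N where "N = (\<lambda>z. (z - z0) / rcis s \<theta>)"
  define M where "M = exterior_to_halfplane \<circ> N"
  have [simp]: "rcis s \<theta> \<noteq> 0" using s by simp
  have N_ray: "N (z0 + rcis s (\<theta> + t)) = cis t" for t
    using s by (simp add: N_def rcis_def cis_mult[symmetric])
  have N_ext: "N z \<noteq> 1 \<and> 1 \<le> cmod (N z)"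
    if z: "s < dist z0 z \<or> (\<exists>t. 0 < t \<and> t < 2 * pi \<and> z = z0 + rcis s (\<theta> + t))" for z
  proof (cases "s < dist z0 z")
    case True
    have "cmod (N z) = dist z0 z / s"
      using s by (simp add: N_def norm_divide dist_norm norm_minus_commute)
    then have "1 < cmod (N z)" using True s by simp
    then show ?thesis by auto
  next
    case False
    then show ?thesis using z N_ray exterior_to_halfplane_cis(1) by fastforce
  qed
  have ext: "N z \<noteq> 1 \<and> 1 \<le> cmod (N z)" if "z \<in> path_image gA \<union> path_image gB" for z
    using that
  proof
    assume "z \<in> path_image gA"
    from gA(5)[OF this] show ?thesis by (intro N_ext) (use t in force)
  next
    assume "z \<in> path_image gB"
    from gB(5)[OF this] show ?thesis by (intro N_ext) (use t in force)
  qed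
  have contM: "continuous_on (path_image gA \<union> path_image gB) M"
    unfolding M_def
  proof (rule continuous_on_compose)
    show "continuous_on (path_image gA \<union> path_image gB) N"
      unfolding N_def by (intro continuous_intros) (use s in auto)
    show "continuous_on (N ` (path_image gA \<union> path_image gB)) exterior_to_halfplane"
      by (rule continuous_on_exterior_to_halfplane) (use ext in auto)
  qed
  have paths: "path (M \<circ> gA)" "path (M \<circ> gB)"
    using gA(1) gB(1) continuous_on_subset[OF contM] by (auto intro!: path_continuous_image)
  define I where "I = path_image (M \<circ> gA) \<union> path_image (M \<circ> gB)"
  have "bounded I" unfolding I_def using paths by (simp add: bounded_path_image)
  then obtain K where K: "\<And>x. x \<in> I \<Longrightarrow> norm x \<le> K" unfolding bounded_iff by blast
  have M2: "0 \<le> x $ 2" if "x \<in> I" for x :: "real^2"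
  proof -
    have "x \<in> M ` (path_image gA \<union> path_image gB)"
      using that by (simp add: I_def path_image_compose image_Un)
    then obtain z where z: "z \<in> path_image gA \<union> path_image gB" "x = M z" by blast
    have "1\<^sup>2 \<le> (cmod (N z))\<^sup>2" using ext[OF z(1)] by (intro power_mono) auto
    then show ?thesis by (simp add: z M_def exterior_to_halfplane_nth)
  qed
  have box: "I \<subseteq> cbox (vector [-K, 0]) (vector [K, K])"
  proof
    fix x :: "real^2" assume x: "x \<in> I"
    have "\<bar>x $ 1\<bar> \<le> K" "\<bar>x $ 2\<bar> \<le> K"
      using K[OF x] component_le_norm_cart[of x] order_trans by blast+
    then show "x \<in> cbox (vector [-K, 0]) (vector [K, K])"
      using M2[OF x] by (auto simp: mem_box_cart forall_2)
  qed
  have ends: "pathstart (M \<circ> gB) = exterior_to_halfplane (cis t4)"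
    "pathfinish (M \<circ> gB) = exterior_to_halfplane (cis t2)"
    "pathstart (M \<circ> gA) = exterior_to_halfplane (cis t3)"
    "pathfinish (M \<circ> gA) = exterior_to_halfplane (cis t1)"
    using gA(3,4) gB(3,4) by (simp_all add: pathstart_compose pathfinish_compose M_def N_ray)
  \<comment> \<open>The path in \<open>B\<close> comes first, as \<open>t4\<close> has the leftmost image.\<close>
  obtain x where "x \<in> path_image (M \<circ> gB)" "x \<in> path_image (M \<circ> gA)"
  proof (rule fashoda_interlace[OF paths(2,1), where a = "vector [-K, 0]" and b = "vector [K, K]"])
    show "path_image (M \<circ> gB) \<subseteq> cbox (vector [-K, 0]) (vector [K, K])"
      "path_image (M \<circ> gA) \<subseteq> cbox (vector [-K, 0]) (vector [K, K])"
      using box by (auto simp: I_def)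
  qed (use t exterior_to_halfplane_cis(3) exterior_to_halfplane_cis_mono in \<open>auto simp: ends\<close>)
  then obtain z w where zw: "z \<in> path_image gA" "w \<in> path_image gB" "M z = M w"
    by (auto simp: path_image_compose)
  have "N z = N w"
    by (rule exterior_to_halfplane_inj) (use zw ext in \<open>auto simp: M_def\<close>)
  then have "z = w" using s by (simp add: N_def)
  then show False using zw gA(2) gB(2) disj by blast
qed

section \<open>Critical zeros of harmonic functions\<close>

text \<open>At a critical zero, \<open>f z - f z0\<close> vanishes to some order \<open>n \<ge> 2\<close>. Hence \<open>Re f\<close> has
  alternating signs on successive rays at angle \<open>pi / n\<close>, and four such rays span less than a full turn.\<close>

lemma Re_no_critical_zero:
  assumes f: "f holomorphic_on S" and S: "open S" "connected S" and z0: "z0 \<in> S"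
    and nonconst: "\<not> f constant_on S"
    and zero: "Re (f z0) = 0" and crit: "deriv f z0 = 0"
    and pos: "connected {z\<in>S. 0 < Re (f z)}" and neg: "connected {z\<in>S. Re (f z) < 0}"
  shows False
proof -
  have nc: "\<not> (\<lambda>w. f w - f z0) constant_on S"
    using nonconst unfolding constant_on_def by (metis eq_diff_eq)
  have hol: "(\<lambda>w. f w - f z0) holomorphic_on S" using f by (intro holomorphic_intros)
  obtain g r n where n: "0 < n" and r: "0 < r" "ball z0 r \<subseteq> S"
    and g: "g holomorphic_on ball z0 r"
      "\<And>w. w \<in> ball z0 r \<Longrightarrow> f w - f z0 = (w - z0) ^ n * g w"
      "\<And>w. w \<in> ball z0 r \<Longrightarrow> g w \<noteq> 0"
    by (rule holomorphic_factor_zero_nonconstant[OF hol S z0 _ nc]) auto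
  have "n \<noteq> 1"
  proof
    assume "n = 1"
    have "(g has_field_derivative deriv g z0) (at z0)"
      using g(1) r(1) by (intro holomorphic_derivI[of _ "ball z0 r"]) auto
    then have "((\<lambda>w. (w - z0) * g w + f z0) has_field_derivative g z0) (at z0)"
      by (auto intro!: derivative_eq_intros)
    then have "(f has_field_derivative g z0) (at z0)"
      by (rule has_field_derivative_transform_within_open[of _ _ _ "ball z0 r"])
         (use g(2) r \<open>n = 1\<close> in \<open>auto simp: algebra_simps\<close>)
    then have "g z0 = 0" using crit DERIV_imp_deriv by fastforce
    then show False using g(3) r by simp
  qed
  then have n2: "2 \<le> real n" using n by simp
  define \<phi> where "\<phi> = Arg (g z0)"
  have "isCont g z0"
    using holomorphic_on_imp_continuous_on[OF g(1)] r(1) by (simp add: continuous_on_eq_continuous_at)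
  then have "isCont (\<lambda>z. Re (cis (- \<phi>) * g z)) z0" by (auto intro!: continuous_intros)
  then have "((\<lambda>z. Re (cis (- \<phi>) * g z)) \<longlongrightarrow> Re (cis (- \<phi>) * g z0)) (nhds z0)"
    unfolding isCont_def by (rule tendsto_at_iff_tendsto_nhds[THEN iffD1])
  moreover have "0 < Re (cis (- \<phi>) * g z0)"
  proof -
    define m where "m = cmod (g z0)"
    have "g z0 = of_real m * cis \<phi>"
      using rcis_cmod_Arg[of "g z0"] by (simp add: m_def \<phi>_def rcis_def)
    then have "cis (- \<phi>) * g z0 = of_real m * (cis (- \<phi>) * cis \<phi>)" by simp
    also have "\<dots> = of_real m" unfolding cis_mult by simp
    finally show ?thesis using g(3) r by (simp add: m_def)
  qed
  ultimately have "\<forall>\<^sub>F z in nhds z0. 0 < Re (cis (- \<phi>) * g z)"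
    by (rule order_tendstoD)
  then obtain d where d: "d > 0" "\<And>z. dist z z0 < d \<Longrightarrow> 0 < Re (cis (- \<phi>) * g z)"
    unfolding eventually_nhds_metric by metis
  define r1 where "r1 = min r d / 2"
  have r1: "0 < r1" "r1 < r" "r1 < d" using r d by (auto simp: r1_def)
  \<comment> \<open>The rays on which the leading term of \<open>f z - f z0\<close> is real, with sign \<open>(-1)^k\<close>.\<close>
  have ray: "z0 + rcis \<rho> ((real k * pi - \<phi>) / n) \<in> S \<and>
             0 < (-1)^k * Re (f (z0 + rcis \<rho> ((real k * pi - \<phi>) / n)))"
    if "0 < \<rho>" "\<rho> \<le> r1" for \<rho> and k :: nat
  proof -
    define z where "z = z0 + rcis \<rho> ((real k * pi - \<phi>) / n)"
    have dz: "dist z z0 = \<rho>" using that by (simp add: z_def dist_norm)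
    have "(z - z0) ^ n = of_real (\<rho> ^ n) * (cis (real k * pi) * cis (- \<phi>))"
      using n unfolding z_def by (simp add: rcis_def power_mult_distrib Complex.DeMoivre cis_mult)
    also have "cis (real k * pi) = (-1) ^ k"
      by (metis Complex.DeMoivre cis_pi)
    finally have "(z - z0) ^ n * g z = of_real (\<rho> ^ n) * ((-1) ^ k * (cis (- \<phi>) * g z))"
      by (simp add: mult_ac)
    moreover have "z \<in> ball z0 r" using dz that r1 by (simp add: dist_commute)
    ultimately have "f z = f z0 + of_real (\<rho> ^ n * (-1) ^ k) * (cis (- \<phi>) * g z)"
      using g(2)[of z] by (simp add: algebra_simps)
    then have "Re (f z) = Re (f z0) + Re (of_real (\<rho> ^ n * (-1) ^ k) * (cis (- \<phi>) * g z))"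
      by (simp only: plus_complex.sel)
    then have "Re (f z) = \<rho> ^ n * (-1) ^ k * Re (cis (- \<phi>) * g z)"
      unfolding zero times_complex.sel Re_complex_of_real Im_complex_of_real by simp
    moreover have "(-1) ^ k * (-1) ^ k = (1::real)"
      by (simp flip: power_mult_distrib)
    ultimately have "(-1)^k * Re (f z) = \<rho> ^ n * Re (cis (- \<phi>) * g z)"
      by (metis mult.assoc mult.commute mult.right_neutral)
    then have "0 < (-1)^k * Re (f z)" using d(2)[of z] dz that r1 by simp
    then show ?thesis using \<open>z \<in> ball z0 r\<close> r(2) by (auto simp: z_def)
  qed
  \<comment> \<open>The shift by \<open>pi / 8\<close> keeps the reference direction \<open>\<theta>\<close> off the four rays.\<close>
  define t where "t = (\<lambda>k::nat. real k * pi / n + pi / 8)"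
  define \<theta> where "\<theta> = - \<phi> / n - pi / 8"
  have \<theta>t: "\<theta> + t k = (real k * pi - \<phi>) / n" for k
    by (simp add: \<theta>_def t_def diff_divide_distrib)
  have cont: "continuous_on S (\<lambda>z. Re (f z))"
    using f by (intro continuous_intros holomorphic_on_imp_continuous_on)
  have op: "open {z\<in>S. 0 < Re (f z)}" "open {z\<in>S. Re (f z) < 0}"
    using continuous_open_preimage[OF cont S(1), of "{0<..}"] continuous_open_preimage[OF cont S(1), of "{..<0}"]
    by (simp_all add: Collect_conj_eq vimage_def)
  show False
  proof (rule no_alternating_rays[OF op(1) pos _ op(2) neg _ _ r1(1), of z0 "t 0" "t 1" "t 2" "t 3" \<theta>])
    show "0 < t 0" "t 0 < t 1" "t 1 < t 2" "t 2 < t 3"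
      using n by (simp_all add: t_def divide_strict_right_mono)
    have "3 * pi / n \<le> 3 * pi / 2" using n2 by (intro divide_left_mono) auto
    then show "t 3 < 2 * pi" unfolding t_def of_nat_numeral using pi_gt_zero by linarith
  qed (use ray[of _ 0] ray[of _ 1] ray[of _ 2] ray[of _ 3] zero in \<open>auto simp: \<theta>t\<close>)
qed

section \<open>Proper local homeomorphisms onto simply connected sets\<close>

lemma finite_fibre_of_locally_injective:
  assumes P: "compact {z\<in>V. F z = w}"
    and locinj: "\<And>z. \<lbrakk>z \<in> V; F z = w\<rbrakk> \<Longrightarrow> \<exists>r>0. inj_on F (ball z r)"
  shows "finite {z\<in>V. F z = w}"
proof -
  define P where "P = {z\<in>V. F z = w}"
  obtain r where r: "\<And>z. z \<in> P \<Longrightarrow> r z > 0 \<and> inj_on F (ball z (r z))"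
    using locinj unfolding P_def by (metis (mono_tags, lifting) mem_Collect_eq)
  have "compact P" using P by (simp add: P_def)
  moreover have "P \<subseteq> (\<Union>z\<in>P. ball z (r z))" using r by force
  ultimately obtain D where D: "D \<subseteq> P" "finite D" "P \<subseteq> (\<Union>z\<in>D. ball z (r z))"
    using compactE_image[of P P "\<lambda>z. ball z (r z)"] by auto
  have "P \<subseteq> D"
  proof
    fix x assume x: "x \<in> P"
    then obtain z where z: "z \<in> D" "x \<in> ball z (r z)" using D by auto
    then have "z \<in> P" using D(1) by auto
    then have "inj_on F (ball z (r z))" "z \<in> ball z (r z)" "F x = F z"
      using r[of z] x by (auto simp: P_def)
    then have "x = z" using z(2) by (meson inj_onD)
    then show "x \<in> D" using z by simp
  qed
  then show ?thesis using D(2) finite_subset by (auto simp: P_def)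
qed

text \<open>A locally injective continuous map between open sets of the same dimension is a local
  homeomorphism; it is proper here because the boundary of the compact set \<open>V\<close> is mapped outside of
  \<open>W\<close>. Hence it is a covering, and the identity of the simply connected set \<open>W\<close> lifts to a section,
  whose image is open and closed in the interior of \<open>V\<close>.\<close>

lemma proper_locally_injective_imp_bij_betw:
  fixes F :: "'a::euclidean_space \<Rightarrow> 'a"
  assumes V: "compact V" "interior V \<noteq> {}" "connected (interior V)"
    and F: "continuous_on V F" "F ` interior V \<subseteq> W" "F ` frontier V \<inter> W = {}"
    and W: "open W" "connected W" "simply_connected W"
    and locinj: "\<And>z. z \<in> interior V \<Longrightarrow> \<exists>r>0. ball z r \<subseteq> interior V \<and> inj_on F (ball z r)"
  shows "bij_betw F (interior V) W"
proof -
  define S where "S = interior V"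
  have S: "open S" "connected S" "S \<noteq> {}" "S \<subseteq> V" using V interior_subset by (auto simp: S_def)
  have contS: "continuous_on S F" using F(1) S(4) continuous_on_subset by blast
  have VS: "V = S \<union> frontier V"
    using V(1) S(4) by (auto simp: S_def frontier_def compact_imp_closed closure_closed)
  have in_S: "z \<in> S" if "z \<in> V" "F z \<in> W" for z
    using that VS F(3) by blast
  have FS: "F ` S \<subseteq> W" using F(2) by (simp add: S_def)
  have opF: "open (F ` B)" if "open B" "B \<subseteq> S" "inj_on F B" for B
    using invariance_of_domain continuous_on_subset[OF contS] that by blast
  have surj: "F ` S = W"
  proof -
    have "open (F ` S)"
    proof (subst open_subopen, safe)
      fix z assume "z \<in> S"
      then obtain r where "r > 0" "ball z r \<subseteq> S" "inj_on F (ball z r)"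
        using locinj by (auto simp: S_def)
      then show "\<exists>T. open T \<and> F z \<in> T \<and> T \<subseteq> F ` S"
        by (intro exI[of _ "F ` ball z r"]) (auto intro: opF)
    qed
    then have "openin (top_of_set W) (F ` S)" using FS by (simp add: open_subset)
    moreover have "F ` S = W \<inter> F ` V"
      using FS in_S S(4) by blast
    then have "closedin (top_of_set W) (F ` S)"
      using V(1) F(1) compact_continuous_image compact_imp_closed closedin_closed_Int by metis
    ultimately show ?thesis
      using W(2) S(3) unfolding connected_clopen by blast
  qed
  have cov: "covering_space S F W"
    unfolding covering_space_def
  proof (intro conjI ballI)
    fix w assume w: "w \<in> W"
    define P where "P = {z\<in>V. F z = w}"
    have PS: "P \<subseteq> S" using in_S w by (auto simp: P_def)
    have "compact P"
    proof -
      have "closed (V \<inter> F -` {w})"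
        using F(1) V(1) by (intro continuous_closed_preimage) (auto simp: compact_imp_closed)
      moreover have "P = V \<inter> (V \<inter> F -` {w})" by (auto simp: P_def)
      ultimately show ?thesis using V(1) compact_Int_closed by metis
    qed
    then have "finite P"
      unfolding P_def by (rule finite_fibre_of_locally_injective) (use in_S w locinj S_def in blast)
    obtain r where r: "\<And>z. z \<in> P \<Longrightarrow> r z > 0 \<and> ball z (r z) \<subseteq> S \<and> inj_on F (ball z (r z))"
      using locinj PS unfolding S_def by (metis subsetD)
    obtain d where d: "\<And>z. d z > 0 \<and> (\<forall>x\<in>P. x \<noteq> z \<longrightarrow> d z \<le> dist z x)"
      using finite_set_avoid[OF \<open>finite P\<close>] by metis
    define N where "N = (\<lambda>z. ball z (min (r z) (d z / 2)))"
    have N: "z \<in> N z" "open (N z)" "N z \<subseteq> S" "inj_on F (N z)" if "z \<in> P" for z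
      using r[OF that] d[of z] by (auto simp: N_def intro: inj_on_subset)
    have Ndisj: "N z \<inter> N z' = {}" if "z \<in> P" "z' \<in> P" "z \<noteq> z'" for z z'
    proof -
      have "d z \<le> dist z z'" using d[of z] that by metis
      moreover have "d z' \<le> dist z z'" unfolding dist_commute[of z] using d[of z'] that by metis
      moreover have False if "x \<in> N z" "x \<in> N z'" for x
      proof -
        have "dist z z' \<le> dist z x + dist z' x" by (metis dist_commute dist_triangle)
        moreover have "dist z x < d z / 2" "dist z' x < d z' / 2" using that by (auto simp: N_def)
        ultimately show False using \<open>d z \<le> dist z z'\<close> \<open>d z' \<le> dist z z'\<close> by linarith
      qed
      ultimately show ?thesis by blast
    qed
    \<comment> \<open>Points of \<open>W\<close> near \<open>w\<close> have all their preimages in the discs \<open>N z\<close>, since \<open>F ` K\<close> is closed.\<close>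
    define K where "K = V - (\<Union>z\<in>P. N z)"
    have "compact K" unfolding K_def using V(1) N(2) by (intro compact_diff open_UN) auto
    moreover have "continuous_on K F"
      using F(1) by (rule continuous_on_subset) (auto simp: K_def)
    ultimately have "closed (F ` K)"
      using compact_continuous_image compact_imp_closed by blast
    define T where "T = (W \<inter> (\<Inter>z\<in>P. F ` N z)) - F ` K"
    have "open T"
      unfolding T_def using W(1) \<open>finite P\<close> N opF \<open>closed (F ` K)\<close>
      by (intro open_Diff open_Int open_INT) auto
    have "w \<notin> F ` K" using N(1) by (auto simp: K_def P_def)
    moreover have "w \<in> F ` N z" if "z \<in> P" for z using N(1)[OF that] that by (auto simp: P_def)
    ultimately have "w \<in> T" using w by (auto simp: T_def)
    have TW: "T \<subseteq> W" by (auto simp: T_def)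
    define v where "v = (\<lambda>z. N z \<inter> F -` T) ` P"
    have op: "open (N z \<inter> F -` T)" if "z \<in> P" for z
      using continuous_open_preimage[of "N z" F T] N[OF that] contS continuous_on_subset \<open>open T\<close> by blast
    show "\<exists>T. w \<in> T \<and> openin (top_of_set W) T \<and> (\<exists>v. \<Union>v = S \<inter> F -` T \<and>
            (\<forall>u\<in>v. openin (top_of_set S) u) \<and> pairwise disjnt v \<and> (\<forall>u\<in>v. \<exists>q. homeomorphism u T F q))"
    proof (intro exI[of _ T] conjI exI[of _ v] ballI)
      show "w \<in> T" by fact
      show "openin (top_of_set W) T" using \<open>open T\<close> TW by (simp add: open_subset)
      show "\<Union>v = S \<inter> F -` T"
      proof
        show "\<Union>v \<subseteq> S \<inter> F -` T" using N(3) by (auto simp: v_def)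
        show "S \<inter> F -` T \<subseteq> \<Union>v"
        proof
          fix x assume x: "x \<in> S \<inter> F -` T"
          then have "x \<notin> K" "x \<in> V" using S(4) by (auto simp: T_def)
          then show "x \<in> \<Union>v" using x by (auto simp: K_def v_def)
        qed
      qed
      show "openin (top_of_set S) u" if "u \<in> v" for u
        using that op N(3) by (auto simp: v_def intro!: open_subset)
      show "pairwise disjnt v"
        using Ndisj by (fastforce simp: v_def pairwise_def disjnt_def)
      show "\<exists>q. homeomorphism u T F q" if u: "u \<in> v" for u
      proof -
        obtain z where z: "z \<in> P" "u = N z \<inter> F -` T" using u unfolding v_def by blast
        have "T \<subseteq> F ` N z" using z(1) by (auto simp: T_def)
        then have "F ` u = T" using z(2) by blast
        moreover have "u \<subseteq> N z" using z(2) by blast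
        then have "continuous_on u F" "inj_on F u"
          using N(3,4)[OF z(1)] contS continuous_on_subset inj_on_subset by blast+
        ultimately show ?thesis
          using invariance_of_domain_homeomorphism[of u F] op[OF z(1), folded z(2)] by (metis order_refl)
      qed
    qed
  qed (use contS surj in auto)
  have "locally path_connected W" using W(1) by (rule open_imp_locally_path_connected)
  then obtain g where g: "continuous_on W g" "g \<in> W \<rightarrow> S" "\<And>y. y \<in> W \<Longrightarrow> F (g y) = y"
    using covering_space_lift[OF cov W(3) _ continuous_on_id, of thesis] by auto
  have gW: "g ` W = {z\<in>S. g (F z) = z}"
  proof
    show "g ` W \<subseteq> {z\<in>S. g (F z) = z}" using g(2,3) by auto
    show "{z\<in>S. g (F z) = z} \<subseteq> g ` W"
    proof
      fix z assume "z \<in> {z\<in>S. g (F z) = z}"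
      then have "F z \<in> W" "z = g (F z)" using FS by auto
      then show "z \<in> g ` W" by blast
    qed
  qed
  have "g ` W = S"
  proof -
    have "inj_on g W" using g(3) by (metis inj_onI)
    then have "open (g ` W)" using invariance_of_domain g(1) W(1) by blast
    then have "openin (top_of_set S) (g ` W)" using g(2) by (intro open_subset) auto
    moreover have "continuous_on S (\<lambda>z. g (F z) - z)"
      using continuous_on_compose2[OF g(1) contS FS] by (intro continuous_intros)
    then have "closedin (top_of_set S) {z\<in>S. g (F z) - z = 0}"
      by (rule continuous_closedin_preimage_constant)
    then have "closedin (top_of_set S) (g ` W)" using gW by simp
    moreover have "W \<noteq> {}" using FS S(3) by auto
    ultimately show ?thesis
      using S(2) unfolding connected_clopen by blast
  qed
  then have "inj_on F S" using gW by (metis (mono_tags, lifting) inj_onI mem_Collect_eq)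
  then show ?thesis using surj by (simp add: bij_betw_def S_def)
qed

section \<open>Lines meeting a convex curve\<close>

lemma frontier_meets_ray_once:
  fixes W :: "'a::euclidean_space set"
  assumes W: "convex W" "bounded W" and w: "w \<in> interior W" and "e \<noteq> 0"
  obtains d where "0 < d" "\<And>t. 0 \<le> t \<Longrightarrow> w + t *\<^sub>R e \<in> frontier W \<longleftrightarrow> t = d"
proof -
  obtain d where d: "0 < d" "w + d *\<^sub>R e \<in> frontier W"
      "\<And>t. \<lbrakk>0 \<le> t; t < d\<rbrakk> \<Longrightarrow> w + t *\<^sub>R e \<in> interior W"
    using ray_to_frontier[OF W(2) w \<open>e \<noteq> 0\<close>] by blast
  have "w + t *\<^sub>R e \<notin> frontier W" if "d < t" for t
  proof
    assume "w + t *\<^sub>R e \<in> frontier W"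
    then have "open_segment w (w + t *\<^sub>R e) \<subseteq> interior W"
      using W(1) w by (intro in_interior_closure_convex_segment) (auto simp: frontier_def)
    moreover have "w + d *\<^sub>R e \<in> open_segment w (w + t *\<^sub>R e)"
      unfolding in_segment using d(1) that \<open>e \<noteq> 0\<close>
      by (intro conjI exI[of _ "d / t"]) (auto simp: algebra_simps)
    ultimately show False using d(2) by (auto simp: frontier_def)
  qed
  then have "w + t *\<^sub>R e \<in> frontier W \<longleftrightarrow> t = d" if "0 \<le> t" for t
    using d that by (metis DiffD2 frontier_def linorder_neqE_linordered_idom)
  then show ?thesis using d(1) that by blast
qed

lemma orthogonal_line_complex:
  fixes c w :: complex
  assumes "c \<noteq> 0" "c \<bullet> w = 0"
  obtains t where "w = t *\<^sub>R (\<i> * c)"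
proof
  have "(Re c)\<^sup>2 + (Im c)\<^sup>2 \<noteq> 0" using assms(1) by (simp add: complex_eq_iff sum_power2_eq_zero_iff)
  moreover have "Re c * Re w + Im c * Im w = 0" using assms(2) by (simp add: inner_complex_def)
  ultimately show "w = (((\<i> * c) \<bullet> w) / ((Re c)\<^sup>2 + (Im c)\<^sup>2)) *\<^sub>R (\<i> * c)"
    by (simp add: complex_eq_iff inner_complex_def divide_simps) (simp add: power2_eq_square; algebra)
qed

lemma convex_frontier_line:
  fixes W :: "complex set"
  assumes W: "convex W" "bounded W" and w0: "w0 \<in> interior W" and "c \<noteq> 0"
  obtains a b where "a \<in> frontier W" "b \<in> frontier W" "a \<noteq> b"
    "\<And>w. w \<in> frontier W \<Longrightarrow> c \<bullet> (w - w0) = 0 \<longleftrightarrow> w = a \<or> w = b"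
proof -
  define e where "e = \<i> * c"
  have e: "e \<noteq> 0" "- e \<noteq> 0" using \<open>c \<noteq> 0\<close> by (auto simp: e_def)
  obtain d1 where d1: "0 < d1" "\<And>t. 0 \<le> t \<Longrightarrow> w0 + t *\<^sub>R e \<in> frontier W \<longleftrightarrow> t = d1"
    using frontier_meets_ray_once[OF W w0 e(1)] by blast
  obtain d2 where d2: "0 < d2" "\<And>t. 0 \<le> t \<Longrightarrow> w0 + t *\<^sub>R (- e) \<in> frontier W \<longleftrightarrow> t = d2"
    using frontier_meets_ray_once[OF W w0 e(2)] by blast
  have ortho: "c \<bullet> e = 0" by (simp add: e_def inner_complex_def)
  show ?thesis
  proof
    show "w0 + d1 *\<^sub>R e \<in> frontier W" "w0 + d2 *\<^sub>R (- e) \<in> frontier W"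
      using d1 d2 by auto
    have "d1 *\<^sub>R e - d2 *\<^sub>R (- e) = (d1 + d2) *\<^sub>R e" by (simp add: algebra_simps)
    then show "w0 + d1 *\<^sub>R e \<noteq> w0 + d2 *\<^sub>R (- e)" using d1(1) d2(1) e(1)
      by (metis add_pos_pos add_left_imp_eq less_irrefl right_minus_eq scaleR_eq_0_iff)
    fix w assume w: "w \<in> frontier W"
    show "c \<bullet> (w - w0) = 0 \<longleftrightarrow> w = w0 + d1 *\<^sub>R e \<or> w = w0 + d2 *\<^sub>R (- e)"
    proof
      assume "c \<bullet> (w - w0) = 0"
      then obtain t where t: "w - w0 = t *\<^sub>R e"
        using orthogonal_line_complex[OF \<open>c \<noteq> 0\<close>] e_def by metis
      show "w = w0 + d1 *\<^sub>R e \<or> w = w0 + d2 *\<^sub>R (- e)"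
      proof (cases "0 \<le> t")
        case True
        have "w = w0 + t *\<^sub>R e" using t by (metis add.commute diff_add_cancel)
        then show ?thesis using d1(2)[OF True] w by auto
      next
        case False
        have "w = w0 + (- t) *\<^sub>R (- e)" using t by (metis add.commute diff_add_cancel scaleR_minus_left scaleR_minus_right minus_minus)
        then show ?thesis using d2(2)[of "- t"] False w by auto
      qed
    next
      assume "w = w0 + d1 *\<^sub>R e \<or> w = w0 + d2 *\<^sub>R (- e)"
      then show "c \<bullet> (w - w0) = 0" using ortho by auto
    qed
  qed
qed

lemma frontier_point_in_direction:
  fixes W :: "'a::euclidean_space set"
  assumes "bounded W" "w0 \<in> interior W" "c \<noteq> 0"
  obtains w where "w \<in> frontier W" "0 < c \<bullet> (w - w0)"
proof -
  obtain d where d: "0 < d" "w0 + d *\<^sub>R c \<in> frontier W" using ray_to_frontier[OF assms] by blast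
  then show ?thesis using that[OF d(2)] \<open>c \<noteq> 0\<close> by simp
qed

section \<open>Harmonic maps onto convex domains\<close>

text \<open>The situation of the theorem, with the components of \<open>F\<close> given in the interior as real parts of
  holomorphic functions \<open>fu\<close> and \<open>fv\<close>.\<close>

locale harmonic_boundary_homeomorphism =
  fixes V W :: "complex set" and F fu fv :: "complex \<Rightarrow> complex" and G :: "complex \<Rightarrow> complex"
  assumes V: "closed_jordan_domain V"
    and W: "convex W" "compact W" "interior W \<noteq> {}"
    and into: "F ` V \<subseteq> W"
    and homeo: "homeomorphism (frontier V) (frontier W) F G"
    and contF: "continuous_on V F"
    and fu: "fu holomorphic_on interior V" "\<And>z. z \<in> interior V \<Longrightarrow> Re (fu z) = Re (F z)"
    and fv: "fv holomorphic_on interior V" "\<And>z. z \<in> interior V \<Longrightarrow> Re (fv z) = Im (F z)"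
begin

text \<open>A holomorphic function with real part \<open>c \<bullet> (F z - w0)\<close>.\<close>

definition component_primitive :: "complex \<Rightarrow> complex \<Rightarrow> complex \<Rightarrow> complex" where
  "component_primitive c w0 z = of_real (Re c) * fu z + of_real (Im c) * fv z - of_real (c \<bullet> w0)"

lemma component_primitive:
  shows "component_primitive c w0 holomorphic_on interior V"
    and "z \<in> interior V \<Longrightarrow> Re (component_primitive c w0 z) = c \<bullet> (F z - w0)"
proof -
  show "component_primitive c w0 holomorphic_on interior V"
    unfolding component_primitive_def by (intro holomorphic_intros fu fv)
  show "Re (component_primitive c w0 z) = c \<bullet> (F z - w0)" if "z \<in> interior V"
    using fu(2)[OF that] fv(2)[OF that]
    by (simp add: component_primitive_def inner_complex_def algebra_simps)
qed

lemma V_facts: "compact V" "closed V" "connected (interior V)" "interior V \<noteq> {}"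
    "closure (interior V) = V" "V = interior V \<union> frontier V"
  using V interior_subset[of V]
  by (auto simp: closed_jordan_domain_def compact_imp_closed frontier_def closure_closed)

lemma continuous_on_component: "continuous_on V (\<lambda>z. c \<bullet> (F z - w0))"
  by (intro continuous_intros contF)

lemma component_not_constant:
  assumes "w0 \<in> interior W" "c \<noteq> 0"
  shows "\<exists>z\<in>interior V. c \<bullet> F z \<noteq> k"
proof (rule ccontr)
  assume "\<not> ?thesis"
  then have "\<And>z. z \<in> interior V \<Longrightarrow> c \<bullet> (F z - 0) = k" by simp
  then have all: "c \<bullet> F z = k" if "z \<in> V" for z
    using continuous_constant_on_closure[of "interior V" "\<lambda>z. c \<bullet> (F z - 0)" k z]
      continuous_on_component[of c 0] V_facts(5) that by simp
  obtain w where w: "w \<in> frontier W" "0 < c \<bullet> (w - w0)"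
    using frontier_point_in_direction[OF compact_imp_bounded[OF W(2)] assms] by blast
  obtain w' where w': "w' \<in> frontier W" "0 < (- c) \<bullet> (w' - w0)"
    using frontier_point_in_direction[OF compact_imp_bounded[OF W(2)] assms(1), of "- c"] assms(2) by auto
  have "F ` frontier V = frontier W" using homeo by (simp add: homeomorphism_def)
  then have "c \<bullet> w = k" "c \<bullet> w' = k"
    using w(1) w'(1) all V_facts(6) by (metis UnI2 imageE)+
  then show False using w(2) w'(2) by (simp add: inner_diff_right)
qed

text \<open>Otherwise a supporting line of \<open>W\<close> at \<open>F z0\<close> would yield a component of \<open>F\<close> with an interior
  minimum, constant by the maximum principle.\<close>

lemma interior_to_interior:
  assumes z0: "z0 \<in> interior V"
  shows "F z0 \<in> interior W"
proof (rule ccontr)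
  assume out: "F z0 \<notin> interior W"
  have "F z0 \<in> W" using into z0 interior_subset by blast
  moreover have "rel_interior W = interior W" using W(3) by (rule rel_interior_nonempty_interior)
  ultimately obtain c where c: "c \<noteq> 0" "\<And>y. y \<in> W \<Longrightarrow> c \<bullet> F z0 \<le> c \<bullet> y"
    using supporting_hyperplane_rel_boundary[OF W(1), of "F z0"] out by metis
  obtain w0 where w0: "w0 \<in> interior W" using W(3) by blast
  have "c \<bullet> F z = c \<bullet> F z0" if z: "z \<in> interior V" for z
  proof -
    have "Re (component_primitive (- c) 0 z) = Re (component_primitive (- c) 0 z0)"
    proof (rule Re_holomorphic_max_imp_constant[OF component_primitive(1) _ V_facts(3) z0 _ z])
      fix w assume "w \<in> interior V"
      moreover have "F w \<in> W" using into \<open>w \<in> interior V\<close> interior_subset by blast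
      ultimately show "Re (component_primitive (- c) 0 w) \<le> Re (component_primitive (- c) 0 z0)"
        using component_primitive(2) z0 c(2) by simp
    qed simp
    then show ?thesis using component_primitive(2) z z0 by simp
  qed
  then show False using component_not_constant[OF w0 c(1)] by blast
qed

lemma positive_part_connected:
  assumes w0: "w0 \<in> interior W" and c: "c \<noteq> 0"
  shows "connected {z\<in>interior V. 0 < c \<bullet> (F z - w0)}"
proof (rule positive_set_connected[OF V continuous_on_component component_primitive])
  obtain a b where ab: "a \<in> frontier W" "b \<in> frontier W" "a \<noteq> b"
    "\<And>w. w \<in> frontier W \<Longrightarrow> c \<bullet> (w - w0) = 0 \<longleftrightarrow> w = a \<or> w = b"
    using convex_frontier_line[OF W(1) compact_imp_bounded[OF W(2)] w0 c] by blast
  obtain w where w: "w \<in> frontier W" "0 < c \<bullet> (w - w0)"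
    using frontier_point_in_direction[OF compact_imp_bounded[OF W(2)] w0 c] by blast
  obtain w' where w': "w' \<in> frontier W" "0 < (- c) \<bullet> (w' - w0)"
    using frontier_point_in_direction[OF compact_imp_bounded[OF W(2)] w0, of "- c"] c by auto
  have FG: "\<And>z. z \<in> frontier V \<Longrightarrow> F z \<in> frontier W \<and> G (F z) = z"
    "\<And>y. y \<in> frontier W \<Longrightarrow> G y \<in> frontier V \<and> F (G y) = y"
    using homeo by (auto simp: homeomorphism_def)
  show "connected {p\<in>frontier V. 0 < c \<bullet> (F p - w0)}"
  proof (rule jordan_curve_positive_part_connected[of _ "G a" "G b" _ "G w" "G w'"])
    show "jordan_curve (frontier V)" using V by (simp add: closed_jordan_domain_def)
    show "G a \<noteq> G b" using FG ab by metis
    show "continuous_on (frontier V) (\<lambda>z. c \<bullet> (F z - w0))"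
      using continuous_on_component V_facts(6) continuous_on_subset by blast
    show "(c \<bullet> (F z - w0) = 0) = (z = G a \<or> z = G b)" if "z \<in> frontier V" for z
      using FG that ab by metis
  qed (use FG ab w w' in auto)
qed

lemma component_not_critical:
  assumes z0: "z0 \<in> interior V" and c: "c \<noteq> 0"
  shows "deriv (component_primitive c (F z0)) z0 \<noteq> 0"
proof
  assume crit: "deriv (component_primitive c (F z0)) z0 = 0"
  define f where "f = component_primitive c (F z0)"
  have w0: "F z0 \<in> interior W" by (rule interior_to_interior[OF z0])
  have Re_f: "Re (f z) = c \<bullet> (F z - F z0)" if "z \<in> interior V" for z
    using component_primitive(2)[OF that] by (simp add: f_def)
  show False
  proof (rule Re_no_critical_zero[of f "interior V" z0])
    show "f holomorphic_on interior V" unfolding f_def by (rule component_primitive)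
    show "\<not> f constant_on interior V"
    proof
      assume "f constant_on interior V"
      then obtain k where "\<And>z. z \<in> interior V \<Longrightarrow> f z = k" by (auto simp: constant_on_def)
      then have "\<And>z. z \<in> interior V \<Longrightarrow> c \<bullet> F z = Re k + c \<bullet> F z0"
        using Re_f by (metis add.commute diff_add_cancel inner_diff_right)
      then show False using component_not_constant[OF w0 c] by blast
    qed
    have "{z\<in>interior V. 0 < Re (f z)} = {z\<in>interior V. 0 < c \<bullet> (F z - F z0)}"
      "{z\<in>interior V. Re (f z) < 0} = {z\<in>interior V. 0 < (- c) \<bullet> (F z - F z0)}"
      using Re_f by auto
    then show "connected {z\<in>interior V. 0 < Re (f z)}" "connected {z\<in>interior V. Re (f z) < 0}"
      using positive_part_connected[OF w0 c] positive_part_connected[OF w0, of "- c"] c by simp_all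
  qed (use crit z0 Re_f V_facts in \<open>auto simp: f_def\<close>)
qed

text \<open>If the derivative at \<open>z0\<close> were singular, its range would be orthogonal to some \<open>c \<noteq> 0\<close>, and
  \<open>z0\<close> would be a critical point of \<open>c \<bullet> F\<close>.\<close>

lemma derivative_injective:
  assumes z0: "z0 \<in> interior V" and D: "(F has_derivative D) (at z0)"
  shows "inj D"
proof (rule ccontr)
  assume "\<not> inj D"
  have lin: "linear D" using D by (rule has_derivative_linear)
  have "\<not> surj D" using \<open>\<not> inj D\<close> linear_surjective_imp_injective[OF lin] by blast
  moreover have "span (range D) = range D"
    unfolding span_eq_iff by (rule linear_subspace_image[OF lin subspace_UNIV])
  ultimately have "span (range D) \<noteq> UNIV" by metis
  then obtain c where "c \<noteq> 0" "\<forall>x\<in>span (range D). c \<bullet> x = 0"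
    using span_not_UNIV_orthogonal by blast
  then have c: "c \<noteq> 0" "\<And>v. c \<bullet> D v = 0" by (auto simp: span_base)
  define f where "f = component_primitive c (F z0)"
  have "(f has_field_derivative deriv f z0) (at z0)"
    unfolding f_def using component_primitive(1) z0 by (intro holomorphic_derivI) auto
  then have "((\<lambda>z. Re (f z)) has_derivative (\<lambda>v. Re (deriv f z0 * v))) (at z0)"
    unfolding has_field_derivative_def by (rule has_derivative_Re)
  moreover have "((\<lambda>z. Re (f z)) has_derivative (\<lambda>v. c \<bullet> D v)) (at z0)"
  proof (rule has_derivative_transform_within_open[of _ _ _ _ "interior V"])
    show "((\<lambda>z. c \<bullet> (F z - F z0)) has_derivative (\<lambda>v. c \<bullet> D v)) (at z0)"
      by (auto intro!: derivative_eq_intros D)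
  qed (use z0 component_primitive(2) in \<open>auto simp: f_def\<close>)
  ultimately have "(\<lambda>v. Re (deriv f z0 * v)) = (\<lambda>v. c \<bullet> D v)"
    by (rule has_derivative_unique)
  then have "Re (deriv f z0 * cnj (deriv f z0)) = 0" using c(2) by (metis (no_types))
  then have "deriv f z0 = 0"
    by (simp add: complex_mult_cnj sum_power2_eq_zero_iff complex_eq_iff flip: power2_eq_square)
  then show False using component_not_critical[OF z0 c(1)] by (simp add: f_def)
qed

lemma locally_injective:
  assumes C1: "C1_on F (interior V)" and z0: "z0 \<in> interior V"
  shows "\<exists>r>0. ball z0 r \<subseteq> interior V \<and> inj_on F (ball z0 r)"
proof -
  obtain D :: "complex \<Rightarrow> complex \<Rightarrow>\<^sub>L complex"
    where D: "\<And>z. z \<in> interior V \<Longrightarrow> (F has_derivative blinfun_apply (D z)) (at z)"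
      and cont: "continuous_on (interior V) D"
    using C1 by (auto simp: C1_on_def)
  have "inj (D z0)" using derivative_injective[OF z0 D[OF z0]] .
  moreover have "linear (D z0)" using D[OF z0] by (rule has_derivative_linear)
  ultimately obtain g where g: "linear g" "g \<circ> D z0 = id"
    using linear_injective_left_inverse by blast
  obtain r where "r > 0" "ball z0 r \<subseteq> interior V" "inj_on F (ball z0 r)"
  proof (rule has_derivative_locally_injective[of z0 "interior V" g "\<lambda>z. blinfun_apply (D z)" F])
    show "bounded_linear g" using g(1) by (simp add: linear_conv_bounded_linear)
    show "\<exists>d>0. \<forall>x. dist z0 x < d \<longrightarrow> onorm (\<lambda>v. D x v - D z0 v) < e" if "0 < e" for e
    proof -
      have "isCont D z0" using cont z0 by (simp add: continuous_on_eq_continuous_at)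
      then obtain d where "d > 0" "\<And>x. dist x z0 < d \<Longrightarrow> dist (D x) (D z0) < e"
        using \<open>0 < e\<close> unfolding continuous_at_eps_delta by blast
      then show ?thesis
        by (intro exI[of _ d]) (simp add: dist_norm norm_blinfun.rep_eq minus_blinfun.rep_eq norm_minus_commute)
    qed
  qed (use z0 g D in auto)
  then show ?thesis by blast
qed

lemma bij_betw_closed_domains:
  assumes C1: "C1_on F (interior V)"
  shows "bij_betw F V W"
proof -
  have bF: "bij_betw F (frontier V) (frontier W)"
    using homeo by (metis homeomorphism_def bij_betw_def inj_on_inverseI)
  have "bij_betw F (interior V) (interior W)"
  proof (rule proper_locally_injective_imp_bij_betw)
    show "F ` frontier V \<inter> interior W = {}"
      using bF by (auto simp: bij_betw_def frontier_def)
    show "simply_connected (interior W)" "connected (interior W)"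
      using W(1) by (simp_all add: convex_imp_simply_connected convex_connected)
  qed (use V_facts contF interior_to_interior locally_injective[OF C1] in auto)
  then have "bij_betw F (interior V \<union> frontier V) (interior W \<union> frontier W)"
    using bF by (rule bij_betw_combine) (auto simp: frontier_def)
  moreover have "W = interior W \<union> frontier W"
    using W(2) interior_subset by (auto simp: frontier_def compact_imp_closed closure_closed)
  ultimately show ?thesis using V_facts(6) by simp
qed

end

theorem theorem2p2:
  fixes V W :: "complex set" and u v :: "complex \<Rightarrow> real" and F :: "complex \<Rightarrow> complex"
  assumes V: "closed_jordan_domain V"
    and W: "closed_jordan_domain W"
    and u: "harmonic_over u V"
    and v: "harmonic_over v V"
    and F: "\<And>z. z \<in> V \<Longrightarrow> F z = Complex (u z) (v z)"
    and F_into: "F ` V \<subseteq> W"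
    and homeo: "\<exists>G. homeomorphism (frontier V) (frontier W) F G"
    and orient: "orientation_preserving_boundary F V W"
    and C0: "continuous_on V F"
    and C1: "C1_on F (interior V)"
    and convex_W: "convex W"
  shows "bij_betw F V W"
proof -
  have sc: "simply_connected (interior V)" using V by (simp add: closed_jordan_domain_def)
  obtain fu where fu: "fu holomorphic_on interior V" "\<And>z. z \<in> interior V \<Longrightarrow> Re (fu z) = u z"
    using harmonic_imp_Re_holomorphic[OF u sc] by blast
  obtain fv where fv: "fv holomorphic_on interior V" "\<And>z. z \<in> interior V \<Longrightarrow> Re (fv z) = v z"
    using harmonic_imp_Re_holomorphic[OF v sc] by blast
  obtain G where G: "homeomorphism (frontier V) (frontier W) F G" using homeo by blast
  have F': "F z = Complex (u z) (v z)" if "z \<in> interior V" for z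
    using F that interior_subset by blast
  interpret harmonic_boundary_homeomorphism V W F fu fv G
    by unfold_locales
       (use V W F_into G C0 convex_W fu fv F' in \<open>auto simp: closed_jordan_domain_def\<close>)
  show ?thesis using C1 by (rule bij_betw_closed_domains)
qed

end
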